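(* Let $G_a\neq G_b$ be two helical groups with structural data as in the context, and let $\mathbf x:(s_1,s_2)\to\mathbb R^2$ be an interface as in the context whose curvature satisfies $\kappa(s)\neq0$ on $(s_1,s_2)$. Introduce the orthonormal basis $$\mathbf e_1=\frac{\mathbf e_b\times\mathbf e_a}{|\mathbf e_b\times\mathbf e_a|},\quad \mathbf e_2=\frac{\mathbf e_b-\mathbf e_a}{|\mathbf e_b-\mathbf e_a|},\quad \mathbf e_3=\mathbf e_1\times\mathbf e_2$$ (the axes $\mathbf e_a,\mathbf e_b$ being non-parallel). Define $0\le\theta_a,\theta_b<2\pi$ and $\rho_a,\rho_b>0$ by $\rho_a\mathbf Q^a_{\theta_a}\mathbf e_1=\mathbf r_a$ and $\rho_b\mathbf Q^b_{\theta_b}\mathbf e_1=\mathbf r_b$. Note that $\mathbf e_a=-\sin\xi\,\mathbf e_2+\cos\xi\,\mathbf e_3$ and $\mathbf e_b=\sin\xi\,\mathbf e_2+\cos\xi\,\mathbf e_3$ for a suitable $0<\xi<\pi$, $\xi\neq\pi/2$. Let $\mathbf u,\mathbf v\in\mathbb R^2$ be defined by $\mathbf u\cdot\mathbf g_b=\mathbf v\cdot\mathbf f_b=0$, $\mathbf u\cdot\mathbf f_b=\mathbf v\cdot\mathbf g_b=1$. Then each locally compatible interface is contained in one of the following cases: (i) (Type 1 elliptic interfaces) $\mathbf f_a=\mathbf f_b$, $\mathbf g_a=-\mathbf g_b$, $\rho_a=\rho_b$, $\theta_a=\theta_b$. In non-arclength parameterization the interface is given by $$\tilde{\mathbf x}(t)=t\,\mathbf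 u+\big(\rho_a\tan\xi\,\sin(t+\theta_a)+c\big)\mathbf v,\qquad t\in(t_1,t_2),$$ for some $c\in\mathbb R$. (ii) (Type 2 elliptic interfaces) $\mathbf f_a=-\mathbf f_b$, $\mathbf g_a=\mathbf g_b$, $\rho_a=\rho_b$, $\theta_a=-\theta_b$ (modulo $2\pi$). In non-arclength parameterization the interface is given by $$\tilde{\mathbf x}(t)=t\,\mathbf u+\big(\rho_a\cot\xi\,\sin(-t+\theta_a)+c\big)\mathbf v,\qquad t\in(t_1,t_2),$$ for some $c\in\mathbb R$. In both cases the formula is converted to arclength parameterization by $\mathbf x(s)=\tilde{\mathbf x}(t(s))$, where $t(s)$ is the inverse of $s(t)=s_1+\int_{t_1}^t|\tilde{\mathbf x}'(\tilde t)|\,d\tilde t$ and $t_2$ is such that $s(t_2)=s_2$.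
   Context: Isometries: $(\mathbf Q|\mathbf c)$ denotes the map $\mathbf w\mapsto\mathbf Q\mathbf w+\mathbf c$ of $\mathbb R^3$. Helical groups. For each phase $k\in\{a,b\}$ the following data are given: a unit vector $\mathbf e_k\in\mathbb R^3$; $\mathbf z_k,\mathbf p_k\in\mathbb R^3$ with $\mathbf r_k:=\mathbf p_k-\mathbf z_k\neq0$ and $\mathbf r_k\cdot\mathbf e_k=0$; $\tau_k\in\mathbb R\setminus\{0\}$; $\vartheta_k\in\mathbb R$; an integer $i_k\ge1$ and $\alpha_k=2\pi/i_k$. Let $\mathbf W^k$ be the linear map $\mathbf W^k\mathbf w=\mathbf e_k\times\mathbf w$, and let $\mathbf Q^k_\omega=\sin\omega\,\mathbf W^k+\cos\omega(\mathbf I-\mathbf e_k\otimes\mathbf e_k)+\mathbf e_k\otimes\mathbf e_k$ be the rotation with axis $\mathbf e_k$ and angle $\omega$. Put $g_k(n,m)=(\mathbf Q^k_{m\vartheta_k+n\alpha_k}\,|\,m\tau_k\mathbf e_k+(\mathbf I-\mathbf Q^k_{m\vartheta_k+n\alpha_k})\mathbf z_k)$ and $G_k=\{g_k(n,m):m\in\mathbb Z,\ n=1,\dots,i_k\}$. Nearest neighbor generators. Let $h_k$ be the smallest integer greater than $2|\mathbf r_k|^2/\tau_k^2-1/2$, and let $A_k$ be the set of integer pairs $(n,m)$ with $-i_k\le n\le i_k$, $|m|\le h_k$ and $g_k(n,m)\neq\mathrm{id}$. Among pairs in $A_k$ choose a minimizer $(n_1,m_1)$ of $d_k^2(n,m)=4|\mathbf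 r_k|^2\sin^2\frac{m\vartheta_k+n\alpha_k}{2}+m^2\tau_k^2$, and then a minimizer of $d_k^2$ over those pairs $(n,m)\in A_k$ with $m_1n\neq mn_1$. Label these two pairs $(n_1^k,m_1^k)$, $(n_2^k,m_2^k)$ in an order such that $m_1^k\ne0$. Set $\psi_k=m_1^k\vartheta_k+n_1^k\alpha_k$, $\beta_k=m_2^k\vartheta_k+n_2^k\alpha_k$ and assume $-\pi/2\le\psi_k,\beta_k\le\pi/2$. Let $q_k^\star$ be the smallest positive integer of the form $-n\,i_k m_1^k/(n_1^km_2^k-n_2^km_1^k)$, $n\in\mathbb Z\setminus\{0\}$. Put $\mathbf f_k=(\psi_k,\beta_k)$, $\mathbf g_k=\tau_k(m_1^k,m_2^k)\in\mathbb R^2$. The nondegeneracy $m_1^kn_2^k\ne m_2^kn_1^k$ is equivalent to $\mathbf f_k\cdot\mathbf g_k^\perp\neq0$, where $(u_1,u_2)^\perp=(-u_2,u_1)$. Positions. For $\mathbf x\in\mathbb R^2$ let $\mathbf y_k(\mathbf x)=\mathbf Q^k_{\mathbf x\cdot\mathbf f_k}\mathbf r_k+(\mathbf x\cdot\mathbf g_k)\mathbf e_k+\mathbf z_k$. Interfaces. An interface is a twice continuously differentiable arclength-parameterized curve $\mathbf x=(\hat p,\hat q):(s_1,s_2)\to\mathbb R^2$ ($|\mathbf x'|=1$) with $0\le\hat q(s)\le\min\{q_a^\star,q_b^\star\}$. Its tangent is $\mathbf t(s)=\mathbf x'(s)$, its normal is $\mathbf n(s)=\mathbf t(s)^\perp$,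 and its curvature $\kappa$ is defined by $\mathbf t'(s)=\kappa(s)\mathbf n(s)$. The interface is locally compatible (between phases $a$ and $b$) if $\frac{d}{ds}\mathbf y_a(\mathbf x(s))=\frac{d}{ds}\mathbf y_b(\mathbf x(s))$ for all $s\in(s_1,s_2)$.
   Formalization: The formula x(s)=x̃(t(s)) is proved up to orientation: either x(s) or the reversed curve x(s₁+s₂−s) equals x̃(t(s)), because reversing an interface keeps all hypotheses while x·f_b then decreases, so the formula as written fails for one orientation. *)

theory Defs
  imports "HOL-Analysis.Analysis"
begin

definition perp :: "real^2 \<Rightarrow> real^2" where
  "perp u = vector [- (u $ 2), u $ 1]"

text \<open>The rotation with axis the unit vector \<open>e\<close> and angle \<open>\<omega>\<close>, i.e. the map
  \<open>sin \<omega> W + cos \<omega> (I - e \<otimes> e) + e \<otimes> e\<close> with \<open>W w = e \<times> w\<close>.\<close>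

definition rot :: "real^3 \<Rightarrow> real \<Rightarrow> real^3 \<Rightarrow> real^3" where
  "rot e \<omega> w = sin \<omega> *\<^sub>R cross3 e w + cos \<omega> *\<^sub>R (w - (e \<bullet> w) *\<^sub>R e) + (e \<bullet> w) *\<^sub>R e"

text \<open>All data attached to one phase: \<open>e, z, p, \<tau>, \<theta>, i\<close> and the two selected
  generators, stored as index pairs \<open>(n\<^sub>1, m\<^sub>1)\<close> and \<open>(n\<^sub>2, m\<^sub>2)\<close> (rotation index first).\<close>

record helix =
  hax :: "real^3"
  hcen :: "real^3"
  hpt :: "real^3"
  htrans :: real
  htwist :: real
  hnum :: int
  hgen1 :: "int \<times> int"
  hgen2 :: "int \<times> int"

definition hrad :: "helix \<Rightarrow> real^3" where
  "hrad H = hpt H - hcen H"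

definition halpha :: "helix \<Rightarrow> real" where
  "halpha H = 2 * pi / of_int (hnum H)"

definition hangle :: "helix \<Rightarrow> int \<times> int \<Rightarrow> real" where
  "hangle H = (\<lambda>(n, m). of_int m * htwist H + of_int n * halpha H)"

definition helem :: "helix \<Rightarrow> int \<times> int \<Rightarrow> real^3 \<Rightarrow> real^3" where
  "helem H nm w =
     rot (hax H) (hangle H nm) w
     + ((of_int (snd nm) * htrans H) *\<^sub>R hax H
        + (hcen H - rot (hax H) (hangle H nm) (hcen H)))"

definition helical_group :: "helix \<Rightarrow> (real^3 \<Rightarrow> real^3) set" where
  "helical_group H = {helem H (n, m) | n m. 1 \<le> n \<and> n \<le> hnum H}"

definition hbound :: "helix \<Rightarrow> int" where
  "hbound H = (LEAST h. of_int h > 2 * (norm (hrad H))\<^sup>2 / (htrans H)\<^sup>2 - 1 / 2)"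

definition admissible_pairs :: "helix \<Rightarrow> (int \<times> int) set" where
  "admissible_pairs H =
     {(n, m). - hnum H \<le> n \<and> n \<le> hnum H \<and> \<bar>m\<bar> \<le> hbound H \<and> helem H (n, m) \<noteq> id}"

definition hdist2 :: "helix \<Rightarrow> int \<times> int \<Rightarrow> real" where
  "hdist2 H nm =
     4 * (norm (hrad H))\<^sup>2 * (sin (hangle H nm / 2))\<^sup>2 + (of_int (snd nm))\<^sup>2 * (htrans H)\<^sup>2"

text \<open>\<open>k\<close> is the pair found first and \<open>l\<close> the one found second; the labels 1 and 2 may be
  attached in either order, subject only to \<open>m\<^sub>1 \<noteq> 0\<close>.\<close>

definition nearest_neighbor_generators :: "helix \<Rightarrow> int \<times> int \<Rightarrow> int \<times> int \<Rightarrow> bool" where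
  "nearest_neighbor_generators H p\<^sub>1 p\<^sub>2 \<longleftrightarrow>
     (\<exists>k l. is_arg_min (hdist2 H) (\<lambda>p. p \<in> admissible_pairs H) k \<and>
            is_arg_min (hdist2 H)
              (\<lambda>p. p \<in> admissible_pairs H \<and> snd k * fst p \<noteq> snd p * fst k) l \<and>
            ((p\<^sub>1, p\<^sub>2) = (k, l) \<or> (p\<^sub>1, p\<^sub>2) = (l, k))) \<and>
     snd p\<^sub>1 \<noteq> 0"

definition hpsi :: "helix \<Rightarrow> real" where
  "hpsi H = hangle H (hgen1 H)"

definition hbeta :: "helix \<Rightarrow> real" where
  "hbeta H = hangle H (hgen2 H)"

definition helical_data :: "helix \<Rightarrow> bool" where
  "helical_data H \<longleftrightarrow>
     norm (hax H) = 1 \<and> hrad H \<noteq> 0 \<and> hrad H \<bullet> hax H = 0 \<and> htrans H \<noteq> 0 \<and> 1 \<le> hnum H \<and>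
     nearest_neighbor_generators H (hgen1 H) (hgen2 H) \<and>
     - pi / 2 \<le> hpsi H \<and> hpsi H \<le> pi / 2 \<and> - pi / 2 \<le> hbeta H \<and> hbeta H \<le> pi / 2"

definition qstar :: "helix \<Rightarrow> int" where
  "qstar H =
     (LEAST q. 0 < q \<and>
        (\<exists>n::int. n \<noteq> 0 \<and>
           real_of_int q =
             - (of_int n * of_int (hnum H) * of_int (snd (hgen1 H))) /
               (of_int (fst (hgen1 H)) * of_int (snd (hgen2 H))
                - of_int (fst (hgen2 H)) * of_int (snd (hgen1 H)))))"

definition hf :: "helix \<Rightarrow> real^2" where
  "hf H = vector [hpsi H, hbeta H]"

definition hg :: "helix \<Rightarrow> real^2" where
  "hg H = htrans H *\<^sub>R vector [of_int (snd (hgen1 H)), of_int (snd (hgen2 H))]"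

definition hpos :: "helix \<Rightarrow> real^2 \<Rightarrow> real^3" where
  "hpos H x = rot (hax H) (x \<bullet> hf H) (hrad H) + (x \<bullet> hg H) *\<^sub>R hax H + hcen H"

definition tangent :: "(real \<Rightarrow> real^2) \<Rightarrow> real \<Rightarrow> real^2" where
  "tangent x s = vector_derivative x (at s)"

definition normal :: "(real \<Rightarrow> real^2) \<Rightarrow> real \<Rightarrow> real^2" where
  "normal x s = perp (tangent x s)"

definition interface :: "helix \<Rightarrow> helix \<Rightarrow> real \<Rightarrow> real \<Rightarrow> (real \<Rightarrow> real^2) \<Rightarrow> bool" where
  "interface A B s\<^sub>1 s\<^sub>2 x \<longleftrightarrow>
     s\<^sub>1 < s\<^sub>2 \<and>
     x C1_differentiable_on {s\<^sub>1<..<s\<^sub>2} \<and>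
     tangent x C1_differentiable_on {s\<^sub>1<..<s\<^sub>2} \<and>
     (\<forall>s\<in>{s\<^sub>1<..<s\<^sub>2}. norm (tangent x s) = 1) \<and>
     (\<forall>s\<in>{s\<^sub>1<..<s\<^sub>2}. 0 \<le> x s $ 2 \<and> x s $ 2 \<le> of_int (min (qstar A) (qstar B)))"

definition is_curvature :: "(real \<Rightarrow> real^2) \<Rightarrow> real \<Rightarrow> real \<Rightarrow> (real \<Rightarrow> real) \<Rightarrow> bool" where
  "is_curvature x s\<^sub>1 s\<^sub>2 \<kappa> \<longleftrightarrow>
     (\<forall>s\<in>{s\<^sub>1<..<s\<^sub>2}. vector_derivative (tangent x) (at s) = \<kappa> s *\<^sub>R normal x s)"

definition locally_compatible ::
    "helix \<Rightarrow> helix \<Rightarrow> real \<Rightarrow> real \<Rightarrow> (real \<Rightarrow> real^2) \<Rightarrow> bool" where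
  "locally_compatible A B s\<^sub>1 s\<^sub>2 x \<longleftrightarrow>
     (\<forall>s\<in>{s\<^sub>1<..<s\<^sub>2}.
        vector_derivative (\<lambda>s. hpos A (x s)) (at s) = vector_derivative (\<lambda>s. hpos B (x s)) (at s))"

text \<open>\<open>x\<close> is the arclength parameterization on \<open>(s\<^sub>1, s\<^sub>2)\<close> of the curve \<open>y\<close> on
  \<open>(t\<^sub>1, t\<^sub>2)\<close>, traversed in the direction of increasing \<open>t\<close>.\<close>

definition arclength_param ::
    "(real \<Rightarrow> real^2) \<Rightarrow> real \<Rightarrow> real \<Rightarrow> (real \<Rightarrow> real^2) \<Rightarrow> real \<Rightarrow> real \<Rightarrow> bool" where
  "arclength_param x s\<^sub>1 s\<^sub>2 y t\<^sub>1 t\<^sub>2 \<longleftrightarrow>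
     (let S = (\<lambda>t. s\<^sub>1 + integral {t\<^sub>1..t} (\<lambda>t'. norm (vector_derivative y (at t'))))
      in S t\<^sub>2 = s\<^sub>2 \<and> bij_betw S {t\<^sub>1<..<t\<^sub>2} {s\<^sub>1<..<s\<^sub>2} \<and>
         (\<forall>s\<in>{s\<^sub>1<..<s\<^sub>2}. x s = y (the_inv_into {t\<^sub>1<..<t\<^sub>2} S s)))"

text \<open>The curve given by \<open>y\<close> carries no orientation of its own: \<open>x\<close> may run along it in
  either direction. If \<open>x\<close> is a locally compatible interface then so is \<open>s \<mapsto> x (s\<^sub>1 + s\<^sub>2 - s)\<close>,
  and exactly one of the two runs in the direction of increasing \<open>t\<close>.\<close>

definition given_by :: "(real \<Rightarrow> real^2) \<Rightarrow> real \<Rightarrow> real \<Rightarrow> (real \<Rightarrow> real^2) \<Rightarrow> bool" where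
  "given_by x s\<^sub>1 s\<^sub>2 y \<longleftrightarrow>
     (\<exists>t\<^sub>1 t\<^sub>2. t\<^sub>1 < t\<^sub>2 \<and>
        (arclength_param x s\<^sub>1 s\<^sub>2 y t\<^sub>1 t\<^sub>2 \<or>
         arclength_param (\<lambda>s. x (s\<^sub>1 + s\<^sub>2 - s)) s\<^sub>1 s\<^sub>2 y t\<^sub>1 t\<^sub>2))"

definition tilt_angle :: "helix \<Rightarrow> helix \<Rightarrow> real^3 \<Rightarrow> real^3 \<Rightarrow> real \<Rightarrow> bool" where
  "tilt_angle A B e\<^sub>2 e\<^sub>3 \<xi> \<longleftrightarrow>
     0 < \<xi> \<and> \<xi> < pi \<and> \<xi> \<noteq> pi / 2 \<and>
     hax A = - sin \<xi> *\<^sub>R e\<^sub>2 + cos \<xi> *\<^sub>R e\<^sub>3 \<and>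
     hax B = sin \<xi> *\<^sub>R e\<^sub>2 + cos \<xi> *\<^sub>R e\<^sub>3"

definition polar_data :: "helix \<Rightarrow> real^3 \<Rightarrow> real \<Rightarrow> real \<Rightarrow> bool" where
  "polar_data H e\<^sub>1 \<rho> \<theta> \<longleftrightarrow>
     0 < \<rho> \<and> 0 \<le> \<theta> \<and> \<theta> < 2 * pi \<and> \<rho> *\<^sub>R rot (hax H) \<theta> e\<^sub>1 = hrad H"

definition dual_basis :: "helix \<Rightarrow> real^2 \<Rightarrow> real^2 \<Rightarrow> bool" where
  "dual_basis H u v \<longleftrightarrow> u \<bullet> hg H = 0 \<and> v \<bullet> hf H = 0 \<and> u \<bullet> hf H = 1 \<and> v \<bullet> hg H = 1"

end

theory Submission
  imports Defs
begin

text \<open>Write \<open>\<phi> = x \<bullet> f + \<theta>\<close> for each phase and let \<open>t\<close> be the unit tangent. Compatibility says that two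
  curves on circular cylinders have the same velocity, which in the basis \<open>e\<^sub>1, e\<^sub>2, e\<^sub>3\<close> gives three
  scalar equations linear in \<open>t\<close>. Comparing speeds gives \<open>\<rho>\<^sub>a\<^sup>2 (t \<bullet> f\<^sub>a)\<^sup>2 + (t \<bullet> g\<^sub>a)\<^sup>2 = \<rho>\<^sub>b\<^sup>2 (t \<bullet> f\<^sub>b)\<^sup>2 + (t \<bullet> g\<^sub>b)\<^sup>2\<close>.
  As the curvature does not vanish, \<open>t\<close> sweeps out directions, so a quadratic form that vanishes on
  all tangents is zero. Differentiating the components along the axes and eliminating the angles
  gives a second such form, a combination of \<open>(t \<bullet> f\<^sub>a)\<^sup>2\<close> and \<open>(t \<bullet> f\<^sub>b)\<^sup>2\<close>, which forces \<open>f\<^sub>a\<close> and \<open>f\<^sub>b\<close>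
  to be parallel. The metric identity and the signs in the second form leave exactly the two cases;
  in each, the remaining equation integrates to a sine graph over \<open>x \<bullet> f\<^sub>b\<close>.\<close>

section \<open>Orthonormal frames, rotations and polar coordinates about an axis\<close>

lemma cross3_orthonormal:
  assumes "norm e = 1" "norm w = 1" "e \<bullet> w = 0"
  shows "norm (cross3 e w) = 1" "cross3 e (cross3 e w) = - w"
    "e \<bullet> cross3 e w = 0" "w \<bullet> cross3 e w = 0"
proof -
  have "(norm (cross3 e w))\<^sup>2 = 1"
    using assms norm_cross_dot[of e w] by simp
  then show "norm (cross3 e w) = 1" using norm_ge_zero[of "cross3 e w"] by (simp add: power2_eq_1_iff)
  show "cross3 e (cross3 e w) = - w"
    using assms by (simp add: Lagrange norm_eq_1)
qed (simp_all add: dot_cross_self)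

text \<open>The residual \<open>d\<close> is orthogonal to \<open>e\<close> and \<open>w\<close>, so
  Lagrange's identity makes its cross product with \<open>cross3 e w\<close> vanish. It is also
  orthogonal to that unit vector, and a vector both parallel and orthogonal to a nonzero vector is
  zero.\<close>

lemma orthonormal_expansion:
  assumes "norm e = 1" "norm w = 1" "e \<bullet> w = 0"
  shows "r = (r \<bullet> e) *\<^sub>R e + (r \<bullet> w) *\<^sub>R w + (r \<bullet> cross3 e w) *\<^sub>R cross3 e w"
proof -
  let ?n = "cross3 e w"
  define d where "d = r - ((r \<bullet> e) *\<^sub>R e + (r \<bullet> w) *\<^sub>R w + (r \<bullet> ?n) *\<^sub>R ?n)"
  note on = cross3_orthonormal[OF assms]
  have "d \<bullet> e = 0" "d \<bullet> w = 0" "d \<bullet> ?n = 0"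
    using on assms by (simp_all add: d_def inner_diff_left inner_add_left inner_diff_right inner_add_right norm_eq_1 inner_commute)
  then have "d \<bullet> ?n = 0 \<and> cross3 d ?n = 0" by (simp add: Lagrange)
  then have "d = 0 \<or> ?n = 0" by (simp add: norm_and_cross_eq_0)
  then show ?thesis using on(1) by (auto simp: d_def)
qed

lemma rot_orthogonal:
  assumes "e \<bullet> w = 0"
  shows "rot e \<omega> w = cos \<omega> *\<^sub>R w + sin \<omega> *\<^sub>R cross3 e w"
  using assms by (simp add: rot_def)

text \<open>Rotations about one axis add their angles. Polar data write the radius vector as
  \<open>\<rho> *\<^sub>R rot e \<theta> w\<close>, so the position on the cylinder depends on one
  phase only.\<close>

lemma rot_rot_orthogonal:
  assumes "norm e = 1" "norm w = 1" "e \<bullet> w = 0"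
  shows "rot e \<omega> (\<rho> *\<^sub>R rot e \<theta> w) =
    \<rho> *\<^sub>R (cos (\<omega> + \<theta>) *\<^sub>R w + sin (\<omega> + \<theta>) *\<^sub>R cross3 e w)"
proof -
  let ?n = "cross3 e w"
  note on = cross3_orthonormal[OF assms]
  have eq: "rot e \<theta> w = cos \<theta> *\<^sub>R w + sin \<theta> *\<^sub>R ?n" using assms(3) by (rule rot_orthogonal)
  have "e \<bullet> (\<rho> *\<^sub>R rot e \<theta> w) = 0" using assms(3) on(3) by (simp add: eq inner_add_right)
  then have "rot e \<omega> (\<rho> *\<^sub>R rot e \<theta> w) =
    \<rho> *\<^sub>R (cos \<omega> *\<^sub>R (cos \<theta> *\<^sub>R w + sin \<theta> *\<^sub>R ?n) + sin \<omega> *\<^sub>R (cos \<theta> *\<^sub>R ?n - sin \<theta> *\<^sub>R w))"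
    by (simp add: rot_orthogonal eq cross_mult_right cross_add_right on(2) scaleR_add_right scaleR_diff_right mult_ac)
  then show ?thesis by (simp add: cos_add sin_add vec_eq_iff algebra_simps)
qed

text \<open>In the orthonormal basis \<open>w\<close>, \<open>cross3 (hax H) w\<close> of the plane
  orthogonal to the axis, \<open>\<rho>\<close> and \<open>\<theta>\<close> are the polar
  coordinates of the nonzero vector \<open>hrad H\<close>.\<close>

lemma ex1_polar_data:
  assumes "norm (hax H) = 1" "norm w = 1" "hax H \<bullet> w = 0" "hrad H \<noteq> 0" "hrad H \<bullet> hax H = 0"
  shows "\<exists>!(\<rho>, \<theta>). polar_data H w \<rho> \<theta>"
proof -
  let ?n = "cross3 (hax H) w" and ?r = "hrad H"
  note on = cross3_orthonormal[OF assms(1-3)]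
  have r: "?r = (?r \<bullet> w) *\<^sub>R w + (?r \<bullet> ?n) *\<^sub>R ?n"
    using orthonormal_expansion[OF assms(1-3), of ?r] assms(5) by simp
  have polar: "polar_data H w \<rho> \<theta> \<longleftrightarrow> 0 < \<rho> \<and> 0 \<le> \<theta> \<and> \<theta> < 2 * pi \<and>
      \<rho> * cos \<theta> = ?r \<bullet> w \<and> \<rho> * sin \<theta> = ?r \<bullet> ?n" for \<rho> \<theta>
  proof -
    have "\<rho> *\<^sub>R rot (hax H) \<theta> w = (\<rho> * cos \<theta>) *\<^sub>R w + (\<rho> * sin \<theta>) *\<^sub>R ?n"
      using assms(3) by (simp add: rot_orthogonal algebra_simps)
    moreover have "x *\<^sub>R w + y *\<^sub>R ?n = ?r \<longleftrightarrow> x = ?r \<bullet> w \<and> y = ?r \<bullet> ?n" for x y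
    proof
      assume "x *\<^sub>R w + y *\<^sub>R ?n = ?r"
      then have "?r \<bullet> w = (x *\<^sub>R w + y *\<^sub>R ?n) \<bullet> w" "?r \<bullet> ?n = (x *\<^sub>R w + y *\<^sub>R ?n) \<bullet> ?n" by simp_all
      then show "x = ?r \<bullet> w \<and> y = ?r \<bullet> ?n"
        using on assms(2) by (simp add: inner_add_left inner_add_right norm_eq_1 inner_commute)
    qed (use r in simp)
    ultimately show ?thesis unfolding polar_data_def by simp
  qed
  let ?R = "norm ?r"
  have R: "?R > 0" using assms(4) by simp
  have "?r \<bullet> ?r = ?r \<bullet> ((?r \<bullet> w) *\<^sub>R w + (?r \<bullet> ?n) *\<^sub>R ?n)" using r by simp
  then have "?R\<^sup>2 = (?r \<bullet> w)\<^sup>2 + (?r \<bullet> ?n)\<^sup>2"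
    unfolding power2_norm_eq_inner by (simp add: inner_add_right power2_eq_square)
  then have sq: "(?r \<bullet> w / ?R)\<^sup>2 + (?r \<bullet> ?n / ?R)\<^sup>2 = 1"
    using R by (auto simp add: power_divide simp flip: add_divide_distrib)
  then obtain t where t: "0 \<le> t" "t < 2 * pi" "?r \<bullet> w / ?R = cos t" "?r \<bullet> ?n / ?R = sin t"
    using sincos_total_2pi by metis
  have ex: "polar_data H w ?R t" using t R by (simp add: polar) (simp add: field_simps)
  have "\<rho> = ?R \<and> \<theta> = t" if "polar_data H w \<rho> \<theta>" for \<rho> \<theta>
  proof -
    have p: "0 < \<rho>" "0 \<le> \<theta>" "\<theta> < 2 * pi" "\<rho> * cos \<theta> = ?R * cos t" "\<rho> * sin \<theta> = ?R * sin t"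
      using that ex by (simp_all add: polar)
    have "\<rho>\<^sup>2 = (\<rho> * cos \<theta>)\<^sup>2 + (\<rho> * sin \<theta>)\<^sup>2"
      by (simp add: power_mult_distrib flip: distrib_left)
    also have "\<dots> = ?R\<^sup>2" unfolding p by (simp add: power_mult_distrib flip: distrib_left)
    finally have "\<rho> = ?R" using p(1) by (simp add: power2_eq_iff_nonneg)
    with p R have "sin \<theta> = sin t" "cos \<theta> = cos t" by auto
    then obtain n :: int where n: "\<theta> = t + 2 * pi * n" using sin_cos_eq_iff by blast
    have "\<bar>2 * pi * n\<bar> < 2 * pi * 1" using n p t by linarith
    then have "\<bar>real_of_int n\<bar> < 1" by (simp add: abs_mult)
    then have "n = 0" by linarith
    with n \<open>\<rho> = ?R\<close> show ?thesis by simp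
  qed
  note unique = this
  show ?thesis
  proof (intro ex1I[of _ "(?R, t)"])
    show "case (?R, t) of (\<rho>, \<theta>) \<Rightarrow> polar_data H w \<rho> \<theta>" using ex by simp
    show "p = (?R, t)" if "case p of (\<rho>, \<theta>) \<Rightarrow> polar_data H w \<rho> \<theta>" for p
      using that unique[of "fst p" "snd p"] by (cases p) simp
  qed
qed

section \<open>The generator vectors and their dual basis\<close>

lemma inner_real2: "(u::real^2) \<bullet> v = u$1 * v$1 + u$2 * v$2"
  by (simp add: inner_vec_def sum_2)

lemma eq_0_if_orthogonal_to_generators:
  assumes indep: "hf H $ 1 * hg H $ 2 - hf H $ 2 * hg H $ 1 \<noteq> 0" and "x \<bullet> hf H = 0" "x \<bullet> hg H = 0"
  shows "x = 0"
proof -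
  have "x$1 * hf H $ 1 + x$2 * hf H $ 2 = 0" "x$1 * hg H $ 1 + x$2 * hg H $ 2 = 0"
    using assms(2,3) by (simp_all add: inner_real2)
  then have "x$1 * (hf H $ 1 * hg H $ 2 - hf H $ 2 * hg H $ 1) = 0"
    "x$2 * (hf H $ 1 * hg H $ 2 - hf H $ 2 * hg H $ 1) = 0" by algebra+
  then show ?thesis using indep by (simp add: vec_eq_iff forall_2)
qed

text \<open>The four conditions are two linear systems with determinant \<open>D\<close> up to sign.
  Cramer's rule solves them explicitly, and existence, uniqueness and the expansion are read off the
  solution.\<close>

lemma dual_basis_expansion:
  assumes "hf H $ 1 * hg H $ 2 - hf H $ 2 * hg H $ 1 \<noteq> 0"
  shows "\<exists>!(u, v). dual_basis H u v"
    and "dual_basis H u v \<Longrightarrow> x = (x \<bullet> hf H) *\<^sub>R u + (x \<bullet> hg H) *\<^sub>R v"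
proof -
  define f1 f2 g1 g2 where d: "f1 = hf H $ 1" "f2 = hf H $ 2" "g1 = hg H $ 1" "g2 = hg H $ 2"
  define D where "D = f1 * g2 - f2 * g1"
  have D: "D \<noteq> 0" using assms by (simp add: d D_def)
  have dual: "dual_basis H u v \<longleftrightarrow> u = vector [g2 / D, - g1 / D] \<and> v = vector [- f2 / D, f1 / D]"
    (is "_ \<longleftrightarrow> ?R") for u v
  proof
    assume "dual_basis H u v"
    then have "u$1 * g1 + u$2 * g2 = 0" "u$1 * f1 + u$2 * f2 = 1"
       "v$1 * f1 + v$2 * f2 = 0" "v$1 * g1 + v$2 * g2 = 1"
      by (simp_all add: dual_basis_def inner_real2 d)
    then have "u$1 * D = g2" "u$2 * D = - g1" "v$1 * D = - f2" "v$2 * D = f1"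
      unfolding D_def by algebra+
    then show ?R using D by (simp add: vec_eq_iff forall_2 field_simps)
  next
    assume ?R
    moreover have "g2 / D * f1 - g1 / D * f2 = 1" "f1 / D * g2 - f2 / D * g1 = 1"
      using D by (simp_all add: D_def algebra_simps flip: diff_divide_distrib)
    ultimately show "dual_basis H u v"
      by (simp add: dual_basis_def inner_real2 flip: d)
  qed
  then show "\<exists>!(u, v). dual_basis H u v" by auto
  assume "dual_basis H u v"
  then show "x = (x \<bullet> hf H) *\<^sub>R u + (x \<bullet> hg H) *\<^sub>R v"
    unfolding dual using D
    by (simp add: vec_eq_iff forall_2 inner_real2 flip: d)
      (simp add: field_simps; simp add: D_def algebra_simps)
qed

text \<open>The twist terms cancel in the determinant and leave \<open>htrans H * halpha H\<close>
  times an integer determinant. That integer is nonzero because the second minimizer ranges only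
  over pairs not proportional to the first; the order of the labels affects just its sign.\<close>

lemma generators_independent:
  assumes "helical_data H"
  shows "hf H $ 1 * hg H $ 2 - hf H $ 2 * hg H $ 1 \<noteq> 0"
proof -
  obtain n1 m1 n2 m2 where g: "hgen1 H = (n1, m1)" "hgen2 H = (n2, m2)" by fastforce
  have "nearest_neighbor_generators H (n1, m1) (n2, m2)" and tr: "htrans H \<noteq> 0" "hnum H \<ge> 1"
    using assms g by (auto simp: helical_data_def)
  then have "n1 * m2 - n2 * m1 \<noteq> 0"
    by (auto simp: nearest_neighbor_generators_def is_arg_min_def mult.commute)
  then have "real_of_int (n1 * m2 - n2 * m1) \<noteq> 0" by linarith
  moreover have "hf H $ 1 * hg H $ 2 - hf H $ 2 * hg H $ 1 =
      htrans H * halpha H * real_of_int (n1 * m2 - n2 * m1)"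
    by (simp add: hf_def hg_def hpsi_def hbeta_def hangle_def g algebra_simps)
  moreover have "halpha H \<noteq> 0" using tr by (simp add: halpha_def)
  ultimately show ?thesis using tr by simp
qed

section \<open>The frame adapted to two non-parallel axes\<close>

text \<open>The sum and the difference of two unit vectors are orthogonal, and both are orthogonal
  to \<open>e1\<close>; hence \<open>e3\<close> lies along the sum. Writing each axis as half the
  sum plus or minus half the difference gives coordinates on the unit circle, whose angle is
  \<open>\<xi>\<close>.\<close>

lemma tilt_frame:
  assumes "norm (hax A) = 1" "norm (hax B) = 1" "cross3 (hax B) (hax A) \<noteq> 0"
    and e1: "e1 = cross3 (hax B) (hax A) /\<^sub>R norm (cross3 (hax B) (hax A))"
    and e2: "e2 = (hax B - hax A) /\<^sub>R norm (hax B - hax A)"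
    and e3: "e3 = cross3 e1 e2"
  shows "norm e1 = 1" "norm e2 = 1" "e1 \<bullet> e2 = 0" "hax A \<bullet> e1 = 0" "hax B \<bullet> e1 = 0"
    "\<exists>!\<xi>. tilt_angle A B e2 e3 \<xi>"
    "tilt_angle A B e2 e3 \<xi> \<Longrightarrow> cos \<xi> \<noteq> 0"
    "tilt_angle A B e2 e3 \<xi> \<Longrightarrow> sin \<xi> \<noteq> 0"
proof -
  let ?a = "hax A" and ?b = "hax B"
  have ne: "?b - ?a \<noteq> 0" using assms(3) by auto
  show n1: "norm e1 = 1" "norm e2 = 1" using assms(3) ne by (simp_all add: e1 e2)
  show o1: "e1 \<bullet> e2 = 0" by (simp add: e1 e2 inner_diff_right dot_cross_self)
  show "?a \<bullet> e1 = 0" "?b \<bullet> e1 = 0" by (simp_all add: e1 dot_cross_self)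
  note on = cross3_orthonormal[OF n1 o1, folded e3]
  define k l where "k = norm (cross3 ?b ?a)" and "l = norm (?b - ?a)"
  have kl: "k > 0" "l > 0" using assms(3) ne by (auto simp: k_def l_def)
  \<comment> \<open>The coefficient is positive for distinct unit vectors, so \<open>e3\<close>
    points along the sum and not against it.\<close>
  have "cross3 (cross3 ?b ?a) (?b - ?a) = (1 - ?a \<bullet> ?b) *\<^sub>R (?a + ?b)"
    using assms(1,2)
    by (simp add: cross_skew[of "cross3 ?b ?a"] Lagrange norm_eq_1 inner_diff_left inner_commute algebra_simps)
  moreover have e3': "e3 = (1 / (k * l)) *\<^sub>R cross3 (cross3 ?b ?a) (?b - ?a)"
    by (simp add: e3 e1 e2 cross_mult_left cross_mult_right divide_inverse flip: k_def l_def)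
  ultimately have e3'': "e3 = ((1 - ?a \<bullet> ?b) / (k * l)) *\<^sub>R (?a + ?b)" by simp
  define q where "q = (1 - ?a \<bullet> ?b) / (k * l)"
  have l2: "l\<^sup>2 = 2 - 2 * (?a \<bullet> ?b)"
    using assms(1,2) unfolding l_def power2_norm_eq_inner
    by (simp add: norm_eq_1 inner_diff_left inner_diff_right inner_commute)
  then have "1 - ?a \<bullet> ?b > 0" using kl by (smt (verit) zero_less_power)
  then have q: "q > 0" using kl by (simp add: q_def)
  have ab: "?b - ?a = l *\<^sub>R e2" "?a + ?b = (1/q) *\<^sub>R e3"
    using kl q by (simp_all add: e2 e3'' flip: q_def l_def)
  have b: "?b = (l/2) *\<^sub>R e2 + (1 / (2*q)) *\<^sub>R e3" "?a = - (l/2) *\<^sub>R e2 + (1 / (2*q)) *\<^sub>R e3"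
  proof -
    have "?b = (1/2) *\<^sub>R ((?b - ?a) + (?a + ?b))" by (simp add: vec_eq_iff)
    then show "?b = (l/2) *\<^sub>R e2 + (1 / (2*q)) *\<^sub>R e3" unfolding ab by (simp add: algebra_simps)
    have "?a = (1/2) *\<^sub>R ((?a + ?b) - (?b - ?a))" by (simp add: vec_eq_iff)
    then show "?a = - (l/2) *\<^sub>R e2 + (1 / (2*q)) *\<^sub>R e3" unfolding ab by (simp add: algebra_simps)
  qed
  have proj: "(y *\<^sub>R e2 + z *\<^sub>R e3) \<bullet> e2 = y" "(y *\<^sub>R e2 + z *\<^sub>R e3) \<bullet> e3 = z" for y z
    using on n1 by (simp_all add: inner_add_left inner_add_right norm_eq_1 inner_commute)
  have bp: "?b \<bullet> e2 = l/2" "?b \<bullet> e3 = 1/(2*q)" using proj b by metis+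
  have "?b \<bullet> ?b = (l/2)\<^sup>2 + (1/(2*q))\<^sup>2"
    by (subst (2) b(1)) (simp add: inner_add_right bp power2_eq_square)
  then have "(1/(2*q))\<^sup>2 + (l/2)\<^sup>2 = 1" using assms(2) by (simp add: norm_eq_1)
  then obtain \<zeta> where xi: "0 \<le> \<zeta>" "\<zeta> < 2 * pi" "1/(2*q) = cos \<zeta>" "l/2 = sin \<zeta>"
    using sincos_total_2pi by metis
  \<comment> \<open>Both coordinates are positive, so the angle lies in the open first
    quadrant.\<close>
  have "sin \<zeta> > 0" "cos \<zeta> > 0" using kl q by (simp_all flip: xi(3,4))
  moreover from this have "\<zeta> \<noteq> 0" "\<zeta> \<noteq> pi / 2" by (metis sin_zero less_irrefl, metis cos_pi_half less_irrefl)
  ultimately have "0 < \<zeta>" "\<zeta> < pi" "\<zeta> \<noteq> pi / 2"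
    using xi(1,2) sin_le_zero[of \<zeta>] by linarith+
  then have ex: "tilt_angle A B e2 e3 \<zeta>" using b xi(3,4) by (simp add: tilt_angle_def)
  have cs: "cos \<eta> = 1/(2*q)" "sin \<eta> = l/2" "0 < \<eta>" "\<eta> < pi" if "tilt_angle A B e2 e3 \<eta>" for \<eta>
    using that bp proj by (auto simp: tilt_angle_def)
  then have "\<eta> = \<zeta>" if "tilt_angle A B e2 e3 \<eta>" for \<eta>
    using that ex cos_inj_pi[of \<eta> \<zeta>] by (smt (verit))
  then show "\<exists>!\<xi>. tilt_angle A B e2 e3 \<xi>" using ex by blast
  assume "tilt_angle A B e2 e3 \<xi>"
  from cs(1,2)[OF this] show "cos \<xi> \<noteq> 0" "sin \<xi> \<noteq> 0" using q kl by simp_all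
qed

section \<open>Tangents of curves with nonvanishing curvature\<close>

lemma has_real_derivative_inner_left:
  assumes "(x has_vector_derivative x') (at s)"
  shows "((\<lambda>s. x s \<bullet> w) has_real_derivative x' \<bullet> w) (at s)"
  using bounded_linear.has_vector_derivative[OF bounded_linear_inner_left assms]
  by (simp add: has_real_derivative_iff_has_vector_derivative)

lemma zero_derivative_on_interval:
  fixes f :: "real \<Rightarrow> real"
  assumes "(f has_real_derivative d) (at s)" "s \<in> {a<..<b}" "\<And>r. r \<in> {a<..<b} \<Longrightarrow> f r = c"
  shows "d = 0"
proof -
  have "((\<lambda>_. c) has_real_derivative d) (at s)"
    using has_field_derivative_transform_within_open[OF assms(1), of "{a<..<b}" "\<lambda>_. c"] assms by simp
  then show ?thesis by (auto intro: DERIV_unique)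
qed

lemma perp_nth [simp]: "perp u $ 1 = - (u $ 2)" "perp u $ 2 = u $ 1"
  by (simp_all add: perp_def)

text \<open>The Frenet equation, stated for the unit tangent alone. A nonzero
  \<open>\<kappa>\<close> can be cancelled after differentiation, which is how identities along the
  curve become identities between constants.\<close>

locale turning_tangent =
  fixes a b :: real and t :: "real \<Rightarrow> real^2" and \<kappa> :: "real \<Rightarrow> real"
  assumes nonempty: "a < b"
    and unit: "s \<in> {a<..<b} \<Longrightarrow> norm (t s) = 1"
    and turning: "s \<in> {a<..<b} \<Longrightarrow> (t has_vector_derivative \<kappa> s *\<^sub>R perp (t s)) (at s)"
    and curved: "s \<in> {a<..<b} \<Longrightarrow> \<kappa> s \<noteq> 0"
begin

lemma DERIV_inner:
  assumes "s \<in> {a<..<b}"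
  shows "((\<lambda>s. t s \<bullet> w) has_real_derivative \<kappa> s * (perp (t s) \<bullet> w)) (at s)"
  using has_real_derivative_inner_left[OF turning[OF assms], of w] by simp

lemma DERIV_nth:
  assumes "s \<in> {a<..<b}"
  shows "((\<lambda>s. t s $ 1) has_real_derivative - \<kappa> s * t s $ 2) (at s)"
    and "((\<lambda>s. t s $ 2) has_real_derivative \<kappa> s * t s $ 1) (at s)"
  using DERIV_inner[OF assms, of "axis 1 1"] DERIV_inner[OF assms, of "axis 2 1"]
  by (simp_all add: inner_real2 axis_def)

lemma unit_sq: "s \<in> {a<..<b} \<Longrightarrow> (t s $ 1)\<^sup>2 + (t s $ 2)\<^sup>2 = 1"
  using unit[of s] by (simp add: norm_eq_1 inner_real2 power2_eq_square)

text \<open>For a tangent at angle \<open>\<alpha>\<close> the form is a constant plus a combination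
  of the cosine and sine of \<open>2 * \<alpha>\<close>. Two differentiations produce, up to a
  factor, the components of \<open>(r - p, q)\<close> rotated by \<open>2 * \<alpha>\<close>; as
  both vanish, only a multiple of the squared length is left.\<close>

lemma quadratic_form_eq_0:
  assumes "\<And>s. s \<in> {a<..<b} \<Longrightarrow> p * (t s $ 1)\<^sup>2 + q * (t s $ 1 * t s $ 2) + r * (t s $ 2)\<^sup>2 = 0"
  shows "p = 0 \<and> q = 0 \<and> r = 0"
proof -
  have 1: "2 * (r - p) * (t s $ 1 * t s $ 2) + q * ((t s $ 1)\<^sup>2 - (t s $ 2)\<^sup>2) = 0"
    if s: "s \<in> {a<..<b}" for s
  proof -
    have "((\<lambda>s. p * (t s $ 1)\<^sup>2 + q * (t s $ 1 * t s $ 2) + r * (t s $ 2)\<^sup>2) has_real_derivative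
      \<kappa> s * (2 * (r - p) * (t s $ 1 * t s $ 2) + q * ((t s $ 1)\<^sup>2 - (t s $ 2)\<^sup>2))) (at s)"
      by (rule derivative_eq_intros DERIV_nth[OF s] refl)+ (simp add: algebra_simps power2_eq_square)
    from zero_derivative_on_interval[OF this s assms] show ?thesis using curved[OF s] by simp
  qed
  obtain s where s: "s \<in> {a<..<b}" using nonempty dense by auto
  \<comment> \<open>The factor \<open>\<kappa>\<close> is already cancelled here, so no derivative
    of \<open>\<kappa>\<close> arises.\<close>
  have "((\<lambda>s. 2 * (r - p) * (t s $ 1 * t s $ 2) + q * ((t s $ 1)\<^sup>2 - (t s $ 2)\<^sup>2)) has_real_derivative
    \<kappa> s * (2 * (r - p) * ((t s $ 1)\<^sup>2 - (t s $ 2)\<^sup>2) - 4 * q * (t s $ 1 * t s $ 2))) (at s)"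
    by (rule derivative_eq_intros DERIV_nth[OF s] refl)+ (simp add: algebra_simps power2_eq_square)
  from zero_derivative_on_interval[OF this s 1]
  have 2: "2 * (r - p) * ((t s $ 1)\<^sup>2 - (t s $ 2)\<^sup>2) - 4 * q * (t s $ 1 * t s $ 2) = 0"
    using curved[OF s] by simp
  \<comment> \<open>The inserted factor is 1. It makes the right side the square of the first
    identity plus the square of half the second.\<close>
  have "(r - p)\<^sup>2 + q\<^sup>2 = ((r - p)\<^sup>2 + q\<^sup>2) * ((t s $ 1)\<^sup>2 + (t s $ 2)\<^sup>2)\<^sup>2"
    using unit_sq[OF s] by simp
  also have "\<dots> = 0" using 1[OF s] 2 by algebra
  finally have "r = p" "q = 0" by (auto simp: sum_power2_eq_zero_iff)
  moreover from this have "p * ((t s $ 1)\<^sup>2 + (t s $ 2)\<^sup>2) = 0"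
    using assms[OF s] by (simp add: algebra_simps)
  ultimately show ?thesis using unit_sq[OF s] by simp
qed

end

section \<open>Rigidity of the two pairs of generator vectors\<close>

text \<open>By \<open>metric\<close>, the matrices with rows \<open>F, G\<close> and
  \<open>F', G'\<close> differ by an orthogonal factor on the left. By \<open>par\<close>,
  \<open>F'\<close> is parallel to \<open>F\<close>, so this factor is triangular; a triangular
  orthogonal matrix is diagonal with entries 1 or -1.\<close>

lemma proportional_frames:
  fixes F G F' G' :: "real^2"
  assumes indep: "F$1 * G$2 - F$2 * G$1 \<noteq> 0"
    and metric: "(F$1)\<^sup>2 + (G$1)\<^sup>2 = (F'$1)\<^sup>2 + (G'$1)\<^sup>2" "(F$2)\<^sup>2 + (G$2)\<^sup>2 = (F'$2)\<^sup>2 + (G'$2)\<^sup>2"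
      "F$1 * F$2 + G$1 * G$2 = F'$1 * F'$2 + G'$1 * G'$2"
    and par: "k * (F'$1)\<^sup>2 + l * (F$1)\<^sup>2 = 0" "k * (F'$2)\<^sup>2 + l * (F$2)\<^sup>2 = 0"
      "k * (F'$1 * F'$2) + l * (F$1 * F$2) = 0" "k \<noteq> 0"
  obtains "F' = F \<or> F' = - F" "G' = G \<or> G' = - G"
proof -
  define D where "D = F$1 * G$2 - F$2 * G$1"
  have D: "D \<noteq> 0" using indep by (simp add: D_def)
  \<comment> \<open>The form in \<open>par\<close> is evaluated in the direction orthogonal to
    \<open>F\<close>, where only the term with \<open>k\<close> survives.\<close>
  have "k * (F$1 * F'$2 - F$2 * F'$1)\<^sup>2 = 0" using par(1-3) by algebra
  then have FF: "F$1 * F'$2 = F$2 * F'$1" using par(4) by simp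
  \<comment> \<open>By Cramer's rule \<open>L / D\<close>, \<open>N / D\<close> and
    \<open>M / D\<close> are the coefficients of \<open>F'\<close> along \<open>F\<close>, of
    \<open>G'\<close> along \<open>G\<close> and of \<open>G'\<close> along \<open>F\<close>. The
    remaining entry is zero by \<open>FF\<close>, and orthogonality settles \<open>N\<close>, then
    \<open>M\<close>, then \<open>L\<close>.\<close>
  define L where "L = F'$1 * G$2 - F'$2 * G$1"
  have L: "F'$1 * D = L * F$1" "F'$2 * D = L * F$2" using FF unfolding D_def L_def by algebra+
  define N where "N = F$1 * G'$2 - F$2 * G'$1"
  define M where "M = G'$1 * G$2 - G'$2 * G$1"
  have "N\<^sup>2 = D\<^sup>2" using metric FF unfolding N_def D_def by algebra
  then have N: "N = D \<or> N = - D" by (simp add: power2_eq_iff)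
  have "N * M = 0" using metric FF unfolding N_def D_def M_def by algebra
  then have M: "M = 0" using N D by auto
  have "L\<^sup>2 = D\<^sup>2" using metric FF M unfolding L_def D_def M_def by algebra
  then have L': "L = D \<or> L = - D" by (simp add: power2_eq_iff)
  have *: "W' = W \<or> W' = - W" if "W'$1 * D = r * W$1" "W'$2 * D = r * W$2" "r = D \<or> r = - D"
    for W W' :: "real^2" and r
    using that(3)
  proof
    assume "r = D"
    with that D have "W'$1 = W$1" "W'$2 = W$2" by auto
    then show ?thesis by (simp add: vec_eq_iff forall_2)
  next
    assume "r = - D"
    with that have "(W'$1 + W$1) * D = 0" "(W'$2 + W$2) * D = 0" by (simp_all add: algebra_simps)
    with D have "W'$1 = - W$1" "W'$2 = - W$2" by auto
    then show ?thesis by (simp add: vec_eq_iff forall_2)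
  qed
  have "F' = F \<or> F' = - F" using *[OF L L'] .
  moreover have "G'$1 * D = N * G$1" "G'$2 * D = N * G$2"
    using M unfolding M_def D_def N_def by algebra+
  then have "G' = G \<or> G' = - G" using * N by blast
  ultimately show ?thesis by (rule that)
qed

context turning_tangent
begin

text \<open>\<open>E1\<close>, \<open>E2\<close>, \<open>E3\<close> are the components of the
  equality of velocities, with \<open>C\<close> and \<open>S\<close> the cosine and sine of the tilt
  angle. Equality of speeds and projection onto the axes each yield a quadratic form vanishing on
  all tangents, as \<open>proportional_frames\<close> requires. The signs of \<open>K\<close> and
  \<open>K'\<close> then decide the case and equate the radii.\<close>

lemma compatible_frames:
  fixes f g f' g' :: "real^2" and \<phi> \<phi>' :: "real \<Rightarrow> real"
  assumes indep: "f$1 * g$2 - f$2 * g$1 \<noteq> 0" and \<rho>: "\<rho> > 0" "\<rho>' > 0"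
    and CS: "C \<noteq> 0" "S \<noteq> 0" "S\<^sup>2 + C\<^sup>2 = 1"
    and d\<phi>: "\<And>s. s \<in> {a<..<b} \<Longrightarrow> (\<phi> has_real_derivative t s \<bullet> f) (at s)"
      "\<And>s. s \<in> {a<..<b} \<Longrightarrow> (\<phi>' has_real_derivative t s \<bullet> f') (at s)"
    and E1: "\<And>s. s \<in> {a<..<b} \<Longrightarrow> \<rho> * (t s \<bullet> f) * sin (\<phi> s) = \<rho>' * (t s \<bullet> f') * sin (\<phi>' s)"
    and E2: "\<And>s. s \<in> {a<..<b} \<Longrightarrow>
      (\<rho> * (t s \<bullet> f) * cos (\<phi> s) - \<rho>' * (t s \<bullet> f') * cos (\<phi>' s)) * C = (t s \<bullet> g + t s \<bullet> g') * S"
    and E3: "\<And>s. s \<in> {a<..<b} \<Longrightarrow>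
      (\<rho> * (t s \<bullet> f) * cos (\<phi> s) + \<rho>' * (t s \<bullet> f') * cos (\<phi>' s)) * S = (t s \<bullet> g' - t s \<bullet> g) * C"
  shows "\<rho> = \<rho>' \<and> (f = f' \<and> g = - g' \<or> f = - f' \<and> g = g')"
proof -
  define F F' where "F = \<rho> *\<^sub>R f" and "F' = \<rho>' *\<^sub>R f'"
  \<comment> \<open>This is the cosine of twice the tilt angle, the inner product of the two
    axes.\<close>
  define c where "c = C\<^sup>2 - S\<^sup>2"
  have c: "1 - c = 2 * S\<^sup>2" "1 + c = 2 * C\<^sup>2" using CS(3) by (simp_all add: c_def)
  note e1 = E1[folded inner_scaleR_right, folded F_def F'_def]
  note e2 = E2[folded inner_scaleR_right, folded F_def F'_def]
  note e3 = E3[folded inner_scaleR_right, folded F_def F'_def]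
  have Dne: "F$1 * g$2 - F$2 * g$1 \<noteq> 0" using indep \<rho> by (simp add: F_def flip: right_diff_distrib)
  \<comment> \<open>The product of \<open>e2\<close> and \<open>e3\<close> is a difference of
    squares; adding the square of \<open>e1\<close> completes it to equality of squared
    speeds.\<close>
  have metric: "(t s \<bullet> F)\<^sup>2 + (t s \<bullet> g)\<^sup>2 = (t s \<bullet> F')\<^sup>2 + (t s \<bullet> g')\<^sup>2" if s: "s \<in> {a<..<b}" for s
  proof -
    have "((t s \<bullet> F * cos (\<phi> s))\<^sup>2 - (t s \<bullet> F' * cos (\<phi>' s))\<^sup>2) * (C * S) = ((t s \<bullet> g')\<^sup>2 - (t s \<bullet> g)\<^sup>2) * (C * S)"
      using e2[OF s] e3[OF s] by algebra
    then have "(t s \<bullet> F * cos (\<phi> s))\<^sup>2 - (t s \<bullet> F' * cos (\<phi>' s))\<^sup>2 = (t s \<bullet> g')\<^sup>2 - (t s \<bullet> g)\<^sup>2"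
      using CS by simp
    then show ?thesis
      using e1[OF s] sin_cos_squared_add[of "\<phi> s"] sin_cos_squared_add[of "\<phi>' s"] by algebra
  qed
  have M: "(F$1)\<^sup>2 + (g$1)\<^sup>2 - (F'$1)\<^sup>2 - (g'$1)\<^sup>2 = 0 \<and>
     2 * (F$1 * F$2 + g$1 * g$2 - F'$1 * F'$2 - g'$1 * g'$2) = 0 \<and>
     (F$2)\<^sup>2 + (g$2)\<^sup>2 - (F'$2)\<^sup>2 - (g'$2)\<^sup>2 = 0"
    by (rule quadratic_form_eq_0)
      (use metric in \<open>simp add: inner_real2 power2_eq_square algebra_simps\<close>)
  \<comment> \<open>\<open>K\<close> is the determinant of \<open>F\<close> and
    \<open>g' - c *\<^sub>R g\<close>, and \<open>K'\<close> that of \<open>F'\<close> and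
    \<open>g - c *\<^sub>R g'\<close>.\<close>
  define K K' where "K = F$1 * g'$2 - F$2 * g'$1 - c * (F$1 * g$2 - F$2 * g$1)"
    and "K' = F'$1 * g$2 - F'$2 * g$1 - c * (F'$1 * g'$2 - F'$2 * g'$1)"
  \<comment> \<open>Projecting the velocities onto the axis of one phase removes the angle of that
    phase.\<close>
  have proj: "2 * S * C * ((t s \<bullet> F) * cos (\<phi> s)) = t s \<bullet> g' - c * (t s \<bullet> g)"
    "2 * S * C * ((t s \<bullet> F') * cos (\<phi>' s)) = c * (t s \<bullet> g') - t s \<bullet> g" if s: "s \<in> {a<..<b}" for s
    using e2[OF s] e3[OF s] CS(3) unfolding c_def by algebra+
  \<comment> \<open>Differentiating \<open>p\<close> and multiplying by
    \<open>t s \<bullet> H\<close> lets \<open>p\<close> itself eliminate the cosine. The terms with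
    \<open>\<kappa>\<close> combine into a determinant independent of \<open>s\<close>, because
    \<open>t s\<close> and \<open>perp (t s)\<close> are orthonormal.\<close>
  have dif: "- 2 * S * C * (sin (\<psi> s) * (t s \<bullet> H) ^ 3) = r * \<kappa> s * (H$1 * w$2 - H$2 * w$1)"
    if s: "s \<in> {a<..<b}" and r: "r \<noteq> 0" and H: "H = r *\<^sub>R h"
      and d: "(\<psi> has_real_derivative t s \<bullet> h) (at s)"
      and p: "\<And>s. s \<in> {a<..<b} \<Longrightarrow> 2 * S * C * ((t s \<bullet> H) * cos (\<psi> s)) = t s \<bullet> w"
    for \<psi> r s and H h w :: "real^2"
  proof -
    have "((\<lambda>s. 2 * S * C * ((t s \<bullet> H) * cos (\<psi> s)) - t s \<bullet> w) has_real_derivative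
       2 * S * C * (\<kappa> s * (perp (t s) \<bullet> H) * cos (\<psi> s) - (t s \<bullet> H) * sin (\<psi> s) * (t s \<bullet> h))
         - \<kappa> s * (perp (t s) \<bullet> w)) (at s)"
      by (rule derivative_eq_intros DERIV_inner[OF s] d refl)+ (simp add: algebra_simps)
    from zero_derivative_on_interval[OF this s, of 0] p
    have "2 * S * C * (\<kappa> s * (perp (t s) \<bullet> H) * cos (\<psi> s) - (t s \<bullet> H) * sin (\<psi> s) * (t s \<bullet> h))
         = \<kappa> s * (perp (t s) \<bullet> w)" by simp
    moreover have "t s \<bullet> H = r * (t s \<bullet> h)" by (simp add: H)
    moreover have "(perp (t s) \<bullet> w) * (t s \<bullet> H) - (t s \<bullet> w) * (perp (t s) \<bullet> H) = H$1 * w$2 - H$2 * w$1"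
      using unit_sq[OF s] unfolding inner_real2 perp_nth by algebra
    ultimately show ?thesis using p[OF s] by algebra
  qed
  have dK: "- 2 * S * C * (sin (\<phi> s) * (t s \<bullet> F) ^ 3) = \<rho> * \<kappa> s * K" if s: "s \<in> {a<..<b}" for s
    using dif[OF s _ F_def d\<phi>(1)[OF s], of "g' - c *\<^sub>R g"] proj(1) \<rho>
    by (simp add: inner_diff_right K_def algebra_simps)
  have dK': "2 * S * C * (sin (\<phi>' s) * (t s \<bullet> F') ^ 3) = \<rho>' * \<kappa> s * K'" if s: "s \<in> {a<..<b}" for s
    using dif[OF s _ F'_def d\<phi>(2)[OF s], of "c *\<^sub>R g' - g"] proj(2) \<rho>
    by (simp add: inner_diff_right K'_def algebra_simps)
  \<comment> \<open>After multiplication by the squares shown, the left sides of \<open>dK\<close>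
    and \<open>dK'\<close> cancel by \<open>e1\<close>.\<close>
  have "\<rho> * K * (t s \<bullet> F')\<^sup>2 + \<rho>' * K' * (t s \<bullet> F)\<^sup>2 = 0" if s: "s \<in> {a<..<b}" for s
  proof -
    have "\<kappa> s * (\<rho> * K * (t s \<bullet> F')\<^sup>2 + \<rho>' * K' * (t s \<bullet> F)\<^sup>2) = 0"
      using dK[OF s] dK'[OF s] e1[OF s] by algebra
    then show ?thesis using curved[OF s] by simp
  qed
  then have par: "\<rho> * K * (F'$1)\<^sup>2 + \<rho>' * K' * (F$1)\<^sup>2 = 0 \<and>
      2 * (\<rho> * K * (F'$1 * F'$2) + \<rho>' * K' * (F$1 * F$2)) = 0 \<and>
      \<rho> * K * (F'$2)\<^sup>2 + \<rho>' * K' * (F$2)\<^sup>2 = 0"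
    by (intro quadratic_form_eq_0) (simp add: inner_real2 power2_eq_square algebra_simps)
  have "K \<noteq> 0"
  proof
    assume "K = 0"
    then have z: "sin (\<phi> s) * (t s \<bullet> F) = 0" if "s \<in> {a<..<b}" for s using dK[OF that] CS by auto
    \<comment> \<open>Where the sine is nonzero, \<open>z\<close> suffices. Where it vanishes, the
      cosine has modulus 1 and the derivative of the product reduces to a nonzero multiple of
      \<open>(t s \<bullet> F)\<^sup>2\<close>.\<close>
    have z': "t s \<bullet> F = 0" if s: "s \<in> {a<..<b}" for s
    proof -
      have "((\<lambda>s. sin (\<phi> s) * (t s \<bullet> F)) has_real_derivative
        cos (\<phi> s) * (t s \<bullet> f) * (t s \<bullet> F) + sin (\<phi> s) * (\<kappa> s * (perp (t s) \<bullet> F))) (at s)"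
        by (rule derivative_eq_intros DERIV_inner[OF s] d\<phi>[OF s] refl)+ simp
      from zero_derivative_on_interval[OF this s z]
      have "cos (\<phi> s) * (t s \<bullet> f) * (t s \<bullet> F) + sin (\<phi> s) * (\<kappa> s * (perp (t s) \<bullet> F)) = 0" .
      moreover have "t s \<bullet> F = \<rho> * (t s \<bullet> f)" by (simp add: F_def)
      ultimately show ?thesis
        using z[OF s] \<rho> sin_zero_abs_cos_one[of "\<phi> s"] by (cases "sin (\<phi> s) = 0") auto
    qed
    have "(F$1)\<^sup>2 = 0 \<and> 2 * (F$1 * F$2) = 0 \<and> (F$2)\<^sup>2 = 0"
      by (rule quadratic_form_eq_0) (drule z', simp add: inner_real2, algebra)
    then show False using Dne by simp
  qed
  then obtain "F' = F \<or> F' = - F" "g' = g \<or> g' = - g"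
    by (rule_tac proportional_frames[of F g F' g' "\<rho> * K" "\<rho>' * K'"]) (use Dne M par \<rho> in auto)
  define D where "D = F$1 * g$2 - F$2 * g$1"
  have "F$1 \<noteq> 0 \<or> F$2 \<noteq> 0" using Dne by auto
  have KK: "\<rho> * K + \<rho>' * K' = 0"
  proof -
    have "(\<rho> * K + \<rho>' * K') * (F$1)\<^sup>2 = 0" "(\<rho> * K + \<rho>' * K') * (F$2)\<^sup>2 = 0"
      using par \<open>F' = F \<or> F' = - F\<close> by (auto simp: algebra_simps)
    then show ?thesis using \<open>F$1 \<noteq> 0 \<or> F$2 \<noteq> 0\<close> by auto
  qed
  have D0: "D \<noteq> 0" using Dne by (simp add: D_def)
  have c0: "1 - c \<noteq> 0" "1 + c \<noteq> 0" using CS by (auto simp: c)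
  \<comment> \<open>Keeping or reversing both vectors gives \<open>K = K'\<close>, which contradicts
    \<open>KK\<close> since the radii are positive.\<close>
  have same: False if "F' = F" "g' = g"
  proof -
    have "K = (1 - c) * D" "K' = (1 - c) * D"
      using that by (auto simp: K_def K'_def D_def algebra_simps)
    then have "(\<rho> + \<rho>') * ((1 - c) * D) = 0" using KK by algebra
    then show False using \<rho> c0 D0 by auto
  qed
  have opp: False if "F' = - F" "g' = - g"
  proof -
    have "K = - (1 + c) * D" "K' = - (1 + c) * D"
      using that by (auto simp: K_def K'_def D_def algebra_simps)
    then have "(\<rho> + \<rho>') * ((1 + c) * D) = 0" using KK by algebra
    then show False using \<rho> c0 D0 by auto
  qed
  have "F' = F \<and> g' = - g \<or> F' = - F \<and> g' = g"
    using same opp \<open>F' = F \<or> F' = - F\<close> \<open>g' = g \<or> g' = - g\<close> by blast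
  \<comment> \<open>Reversing exactly one vector gives \<open>K' = - K\<close>, so \<open>KK\<close>
    equates the radii.\<close>
  moreover have "\<rho> = \<rho>'" if "F' = F \<and> g' = - g"
  proof -
    have "K = - (1 + c) * D" "K' = (1 + c) * D"
      using that by (auto simp: K_def K'_def D_def algebra_simps)
    then have "(\<rho> - \<rho>') * ((1 + c) * D) = 0" using KK by algebra
    then show ?thesis using c0 D0 by auto
  qed
  moreover have "\<rho> = \<rho>'" if "F' = - F \<and> g' = g"
  proof -
    have "K = (1 - c) * D" "K' = - (1 - c) * D"
      using that by (auto simp: K_def K'_def D_def algebra_simps)
    then have "(\<rho> - \<rho>') * ((1 - c) * D) = 0" using KK by algebra
    then show ?thesis using c0 D0 by auto
  qed
  moreover have "f = f'" if "F' = F" "\<rho> = \<rho>'"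
    using that \<rho> by (simp add: F_def F'_def)
  moreover have "f = - f'" if "F' = - F" "\<rho> = \<rho>'"
    using that \<rho> scaleR_cancel_left[of \<rho> f' "- f"] by (simp add: F_def F'_def)
  ultimately show ?thesis by auto
qed

end

section \<open>Arclength parameterization of regular curves\<close>

text \<open>An antiderivative \<open>G\<close> of the speed of \<open>y\<close>, normalized by
  \<open>G (\<tau> s) = s\<close>, is the arclength function on the whole line. The lower bound on
  the speed makes it bijective, so the endpoints \<open>t\<^sub>1\<close> and
  \<open>t\<^sub>2\<close> exist although \<open>\<tau>\<close> is controlled only inside the open
  interval.\<close>

lemma arclength_param_of_increasing:
  fixes y :: "real \<Rightarrow> real^2"
  assumes "s\<^sub>1 < s\<^sub>2"
    and y: "\<And>r. (y has_vector_derivative y' r) (at r)" "continuous_on UNIV y'" "\<And>r. norm (y' r) \<ge> c" "c > 0"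
    and \<tau>: "\<And>s. s \<in> {s\<^sub>1<..<s\<^sub>2} \<Longrightarrow> (\<tau> has_real_derivative \<tau>' s) (at s)"
      "\<And>s. s \<in> {s\<^sub>1<..<s\<^sub>2} \<Longrightarrow> \<tau>' s > 0"
    and x: "\<And>s. s \<in> {s\<^sub>1<..<s\<^sub>2} \<Longrightarrow> x s = y (\<tau> s)"
      "\<And>s. s \<in> {s\<^sub>1<..<s\<^sub>2} \<Longrightarrow> norm (vector_derivative x (at s)) = 1"
  shows "\<exists>t\<^sub>1 t\<^sub>2. t\<^sub>1 < t\<^sub>2 \<and> arclength_param x s\<^sub>1 s\<^sub>2 y t\<^sub>1 t\<^sub>2"
proof -
  have "isCont (\<lambda>r. norm (y' r)) r" for r
    using y(2) by (simp add: continuous_on_eq_continuous_at isCont_norm)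
  then obtain G0 where "\<And>r. (G0 has_vector_derivative norm (y' r)) (at r)"
    using einterval_antiderivative[of "- \<infinity>" \<infinity> "\<lambda>r. norm (y' r)"] by auto
  then have G0: "(G0 has_real_derivative norm (y' r)) (at r)" for r
    by (simp add: has_real_derivative_iff_has_vector_derivative)
  have speed: "norm (y' (\<tau> s)) * \<tau>' s = 1" if s: "s \<in> {s\<^sub>1<..<s\<^sub>2}" for s
  proof -
    have "(\<tau> has_vector_derivative \<tau>' s) (at s)"
      using \<tau>(1)[OF s] by (simp add: has_real_derivative_iff_has_vector_derivative)
    from vector_diff_chain_at[OF this y(1)]
    have "((\<lambda>s. y (\<tau> s)) has_vector_derivative \<tau>' s *\<^sub>R y' (\<tau> s)) (at s)" by (simp add: o_def)
    then have "(x has_vector_derivative \<tau>' s *\<^sub>R y' (\<tau> s)) (at s)"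
      by (rule has_vector_derivative_transform_within_open[of _ _ _ "{s\<^sub>1<..<s\<^sub>2}"]) (use s x in auto)
    then have "norm (\<tau>' s *\<^sub>R y' (\<tau> s)) = 1" using x(2)[OF s] by (simp add: vector_derivative_at)
    then show ?thesis using \<tau>(2)[OF s] by (simp add: mult.commute)
  qed
  \<comment> \<open>Unit speed of \<open>x\<close> makes \<open>G0 (\<tau> s)\<close> grow at rate
    1; the constant \<open>k\<close> is then absorbed into \<open>G\<close>.\<close>
  have "((\<lambda>s. G0 (\<tau> s) - s) has_real_derivative 0) (at s within {s\<^sub>1<..<s\<^sub>2})" if s: "s \<in> {s\<^sub>1<..<s\<^sub>2}" for s
  proof -
    have "((\<lambda>s. G0 (\<tau> s) - s) has_real_derivative norm (y' (\<tau> s)) * \<tau>' s - 1) (at s)"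
      by (intro DERIV_diff DERIV_ident DERIV_chain2[OF G0 \<tau>(1)[OF s]])
    then show ?thesis using speed[OF s] by (simp add: has_field_derivative_at_within)
  qed
  then obtain k where k: "\<And>s. s \<in> {s\<^sub>1<..<s\<^sub>2} \<Longrightarrow> G0 (\<tau> s) - s = k"
    using has_field_derivative_zero_constant[of "{s\<^sub>1<..<s\<^sub>2}" "\<lambda>s. G0 (\<tau> s) - s"] by auto
  define G where "G r = G0 r - k" for r
  have G: "(G has_real_derivative norm (y' r)) (at r)" for r
    unfolding G_def using G0 by (auto intro!: derivative_eq_intros)
  have G\<tau>: "G (\<tau> s) = s" if "s \<in> {s\<^sub>1<..<s\<^sub>2}" for s using k[OF that] by (simp add: G_def)
  have growth: "G q - G p \<ge> c * (q - p)" if "p \<le> q" for p q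
  proof -
    have "G p - c * p \<le> G q - c * q"
    proof (rule DERIV_nonneg_imp_nondecreasing[OF that])
      fix r show "\<exists>d. ((\<lambda>r. G r - c * r) has_real_derivative d) (at r) \<and> 0 \<le> d"
        using y(3)[of r] by (intro exI[of _ "norm (y' r) - c"]) (auto intro!: derivative_eq_intros G)
    qed
    then show ?thesis by (simp add: algebra_simps)
  qed
  have mono: "G p < G q \<longleftrightarrow> p < q" for p q
  proof -
    have "G p < G q" if "p < q" for p q
      using growth[of p q] mult_pos_pos[of c "q - p"] that y(4) by linarith
    then show ?thesis by (metis less_asym linorder_neqE)
  qed
  \<comment> \<open>At distance \<open>R\<close> from 0 the linear growth of \<open>G\<close> has
    reached \<open>s\<close> from either side.\<close>
  have surj: "\<exists>r. G r = s" for s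
  proof -
    define R where "R = \<bar>s - G 0\<bar> / c"
    have R: "R \<ge> 0" "c * R = \<bar>s - G 0\<bar>" using y(4) by (simp_all add: R_def)
    have "G (- R) \<le> s" "s \<le> G R" using growth[of "- R" 0] growth[of 0 R] R by auto
    moreover have "continuous_on {-R..R} G" using G by (meson DERIV_isCont continuous_at_imp_continuous_on)
    ultimately show ?thesis using IVT'[of G "- R" s R] R by auto
  qed
  obtain t\<^sub>1 t\<^sub>2 where t: "G t\<^sub>1 = s\<^sub>1" "G t\<^sub>2 = s\<^sub>2" using surj by metis
  have "t\<^sub>1 < t\<^sub>2" using t assms(1) mono[of t\<^sub>1 t\<^sub>2] by simp
  define S where "S r = s\<^sub>1 + integral {t\<^sub>1..r} (\<lambda>r'. norm (vector_derivative y (at r')))" for r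
  \<comment> \<open>Below \<open>t\<^sub>1\<close> the integral runs over the empty interval and
    \<open>S\<close> is constant.\<close>
  have S: "S r = G r" if "t\<^sub>1 \<le> r" for r
  proof -
    have "((\<lambda>r. norm (y' r)) has_integral G r - G t\<^sub>1) {t\<^sub>1..r}"
      by (rule fundamental_theorem_of_calculus[OF that])
        (use G in \<open>simp add: has_real_derivative_iff_has_vector_derivative has_vector_derivative_at_within\<close>)
    then show ?thesis using t vector_derivative_at[OF y(1)] by (simp add: S_def integral_unique)
  qed
  have inj: "inj_on S {t\<^sub>1<..<t\<^sub>2}"
  proof (rule inj_onI)
    fix p q assume "p \<in> {t\<^sub>1<..<t\<^sub>2}" "q \<in> {t\<^sub>1<..<t\<^sub>2}" "S p = S q"
    then have "G p = G q" using S by simp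
    then show "p = q" using mono[of p q] mono[of q p] by linarith
  qed
  have image: "S ` {t\<^sub>1<..<t\<^sub>2} = {s\<^sub>1<..<s\<^sub>2}"
  proof -
    have "S ` {t\<^sub>1<..<t\<^sub>2} = G ` {t\<^sub>1<..<t\<^sub>2}" using S by (intro image_cong) auto
    also have "\<dots> = {s\<^sub>1<..<s\<^sub>2}"
    proof (intro equalityI subsetI)
      fix s assume "s \<in> {s\<^sub>1<..<s\<^sub>2}"
      moreover obtain r where "s = G r" using surj[of s] by auto
      ultimately show "s \<in> G ` {t\<^sub>1<..<t\<^sub>2}" using mono[of t\<^sub>1 r] mono[of r t\<^sub>2] t by simp
    next
      fix s assume "s \<in> G ` {t\<^sub>1<..<t\<^sub>2}"
      then obtain r where "s = G r" "t\<^sub>1 < r" "r < t\<^sub>2" by auto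
      then show "s \<in> {s\<^sub>1<..<s\<^sub>2}" using mono[of t\<^sub>1 r] mono[of r t\<^sub>2] t by simp
    qed
    finally show ?thesis .
  qed
  have "x s = y (the_inv_into {t\<^sub>1<..<t\<^sub>2} S s)" if s: "s \<in> {s\<^sub>1<..<s\<^sub>2}" for s
  proof -
    have "\<tau> s \<in> {t\<^sub>1<..<t\<^sub>2}" using G\<tau>[OF s] s t mono[of t\<^sub>1 "\<tau> s"] mono[of "\<tau> s" t\<^sub>2] by simp
    then have "the_inv_into {t\<^sub>1<..<t\<^sub>2} S s = \<tau> s"
      using S G\<tau>[OF s] by (intro the_inv_into_f_eq[OF inj]) auto
    then show ?thesis using x(1)[OF s] by simp
  qed
  moreover have "S t\<^sub>2 = s\<^sub>2" using S t \<open>t\<^sub>1 < t\<^sub>2\<close> by simp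
  ultimately have "arclength_param x s\<^sub>1 s\<^sub>2 y t\<^sub>1 t\<^sub>2"
    unfolding arclength_param_def Let_def bij_betw_def using inj image by (simp flip: S_def)
  then show ?thesis using \<open>t\<^sub>1 < t\<^sub>2\<close> by blast
qed

text \<open>A continuous \<open>\<tau>'\<close> without zeros has one sign on the interval. If it is
  negative, reversing \<open>x\<close> makes it positive, which is the second alternative in
  \<open>given_by\<close>.\<close>

lemma given_by_of_regular:
  fixes y :: "real \<Rightarrow> real^2"
  assumes "s\<^sub>1 < s\<^sub>2"
    and y: "\<And>r. (y has_vector_derivative y' r) (at r)" "continuous_on UNIV y'" "\<And>r. norm (y' r) \<ge> c" "c > 0"
    and \<tau>: "\<And>s. s \<in> {s\<^sub>1<..<s\<^sub>2} \<Longrightarrow> (\<tau> has_real_derivative \<tau>' s) (at s)"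
      "continuous_on {s\<^sub>1<..<s\<^sub>2} \<tau>'" "\<And>s. s \<in> {s\<^sub>1<..<s\<^sub>2} \<Longrightarrow> \<tau>' s \<noteq> 0"
    and x: "\<And>s. s \<in> {s\<^sub>1<..<s\<^sub>2} \<Longrightarrow> x s = y (\<tau> s)"
      "\<And>s. s \<in> {s\<^sub>1<..<s\<^sub>2} \<Longrightarrow> (x has_vector_derivative x' s) (at s)"
      "\<And>s. s \<in> {s\<^sub>1<..<s\<^sub>2} \<Longrightarrow> norm (x' s) = 1"
  shows "given_by x s\<^sub>1 s\<^sub>2 y"
proof -
  have "connected (\<tau>' ` {s\<^sub>1<..<s\<^sub>2})" using \<tau>(2) by (intro connected_continuous_image) auto
  moreover have "0 \<notin> \<tau>' ` {s\<^sub>1<..<s\<^sub>2}" using \<tau>(3) by auto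
  ultimately have "(\<forall>s\<in>{s\<^sub>1<..<s\<^sub>2}. \<tau>' s > 0) \<or> (\<forall>s\<in>{s\<^sub>1<..<s\<^sub>2}. \<tau>' s < 0)"
    using \<tau>(3) connectedD_interval[of "\<tau>' ` {s\<^sub>1<..<s\<^sub>2}" _ _ 0]
    by (smt (verit, best) image_eqI)
  then show ?thesis
  proof
    assume "\<forall>s\<in>{s\<^sub>1<..<s\<^sub>2}. \<tau>' s > 0"
    then have "\<exists>t\<^sub>1 t\<^sub>2. t\<^sub>1 < t\<^sub>2 \<and> arclength_param x s\<^sub>1 s\<^sub>2 y t\<^sub>1 t\<^sub>2"
      using arclength_param_of_increasing[OF assms(1) y \<tau>(1), of x] x(1,3) vector_derivative_at[OF x(2)]
      by simp
    then show ?thesis unfolding given_by_def by blast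
  next
    assume neg: "\<forall>s\<in>{s\<^sub>1<..<s\<^sub>2}. \<tau>' s < 0"
    let ?r = "\<lambda>s. s\<^sub>1 + s\<^sub>2 - s"
    have r: "?r s \<in> {s\<^sub>1<..<s\<^sub>2}" if "s \<in> {s\<^sub>1<..<s\<^sub>2}" for s using that by auto
    have "\<exists>t\<^sub>1 t\<^sub>2. t\<^sub>1 < t\<^sub>2 \<and> arclength_param (\<lambda>s. x (?r s)) s\<^sub>1 s\<^sub>2 y t\<^sub>1 t\<^sub>2"
    proof (rule arclength_param_of_increasing[OF assms(1) y, of "\<lambda>s. \<tau> (?r s)" "\<lambda>s. - \<tau>' (?r s)"])
      fix s assume s: "s \<in> {s\<^sub>1<..<s\<^sub>2}"
      have d: "(?r has_real_derivative - 1) (at s)" by (auto intro!: derivative_eq_intros)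
      show "((\<lambda>s. \<tau> (?r s)) has_real_derivative - \<tau>' (?r s)) (at s)"
        using DERIV_chain2[OF \<tau>(1)[OF r[OF s]] d] by simp
      show "0 < - \<tau>' (?r s)" using neg r[OF s] by auto
      show "x (?r s) = y (\<tau> (?r s))" using x(1)[OF r[OF s]] .
      have "(?r has_vector_derivative - 1) (at s)" using d by (simp add: has_real_derivative_iff_has_vector_derivative)
      from vector_diff_chain_at[OF this x(2)[OF r[OF s]]]
      have "((\<lambda>s. x (?r s)) has_vector_derivative - x' (?r s)) (at s)" by (simp add: o_def)
      then show "norm (vector_derivative (\<lambda>s. x (?r s)) (at s)) = 1"
        using x(3)[OF r[OF s]] by (simp add: vector_derivative_at)
    qed
    then show ?thesis unfolding given_by_def by blast
  qed
qed

section \<open>Velocities on a cylinder and interfaces as graphs\<close>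

text \<open>By \<open>rot_rot_orthogonal\<close> the position runs on a cylinder of radius
  \<open>\<rho>\<close> with phase \<open>x s \<bullet> hf H + \<theta>\<close>. The velocity splits
  into a circular and an axial part, the form in which the two phases are compared.\<close>

lemma hpos_has_vector_derivative:
  assumes "norm (hax H) = 1" "norm e = 1" "hax H \<bullet> e = 0" and polar: "polar_data H e \<rho> \<theta>"
    and x: "(x has_vector_derivative x') (at s)"
  shows "((\<lambda>s. hpos H (x s)) has_vector_derivative
    (\<rho> * (x' \<bullet> hf H)) *\<^sub>R (cos (x s \<bullet> hf H + \<theta>) *\<^sub>R cross3 (hax H) e - sin (x s \<bullet> hf H + \<theta>) *\<^sub>R e)
    + (x' \<bullet> hg H) *\<^sub>R hax H) (at s)"
proof -
  have hpos: "hpos H (x s) = (\<rho> * cos (x s \<bullet> hf H + \<theta>)) *\<^sub>R e +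
     (\<rho> * sin (x s \<bullet> hf H + \<theta>)) *\<^sub>R cross3 (hax H) e + (x s \<bullet> hg H) *\<^sub>R hax H + hcen H" for s
  proof -
    have "rot (hax H) (x s \<bullet> hf H) (hrad H) = rot (hax H) (x s \<bullet> hf H) (\<rho> *\<^sub>R rot (hax H) \<theta> e)"
      using polar unfolding polar_data_def by argo
    then show ?thesis
      unfolding hpos_def rot_rot_orthogonal[OF assms(1-3)] by (simp add: scaleR_add_right)
  qed
  have d: "((\<lambda>s. x s \<bullet> w) has_real_derivative x' \<bullet> w) (at s)" for w
    by (rule has_real_derivative_inner_left[OF x])
  have sc: "((\<lambda>s. h s *\<^sub>R w) has_vector_derivative h' *\<^sub>R w) (at s)"
    if "(h has_real_derivative h') (at s)" for h h' and w :: "real^3"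
    using has_vector_derivative_scaleR[OF that has_vector_derivative_const[of w]] by simp
  have d\<phi>: "((\<lambda>s. x s \<bullet> hf H + \<theta>) has_real_derivative x' \<bullet> hf H) (at s)"
    using DERIV_add[OF d DERIV_const] by simp
  note dc = DERIV_cmult[OF DERIV_chain2[OF DERIV_cos d\<phi>], of \<rho>]
  note ds = DERIV_cmult[OF DERIV_chain2[OF DERIV_sin d\<phi>], of \<rho>]
  have "((\<lambda>s. hpos H (x s)) has_vector_derivative
     (\<rho> * (- sin (x s \<bullet> hf H + \<theta>) * (x' \<bullet> hf H))) *\<^sub>R e +
     (\<rho> * (cos (x s \<bullet> hf H + \<theta>) * (x' \<bullet> hf H))) *\<^sub>R cross3 (hax H) e +
     (x' \<bullet> hg H) *\<^sub>R hax H + 0) (at s)"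
    unfolding hpos
    by (rule has_vector_derivative_add[OF has_vector_derivative_add[OF has_vector_derivative_add[OF
            sc[OF dc] sc[OF ds]] sc[OF d]] has_vector_derivative_const])
  moreover have "(\<rho> * (- sin \<phi> * q)) *\<^sub>R e + (\<rho> * (cos \<phi> * q)) *\<^sub>R n + m + 0 =
      (\<rho> * q) *\<^sub>R (cos \<phi> *\<^sub>R n - sin \<phi> *\<^sub>R e) + m" for \<phi> q :: real and n m :: "real^3"
    by (simp add: vec_eq_iff algebra_simps)
  ultimately show ?thesis by metis
qed

text \<open>By \<open>slope\<close>, \<open>x s \<bullet> hg H\<close> and
  \<open>h (x s \<bullet> hf H)\<close> have the same derivative, so they differ by a constant
  \<open>c\<close>. Expanding \<open>x s\<close> in the dual basis then puts it on the
  graph.\<close>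

lemma graph_given_by:
  fixes h h' :: "real \<Rightarrow> real"
  assumes indep: "hf H $ 1 * hg H $ 2 - hf H $ 2 * hg H $ 1 \<noteq> 0" and uv: "dual_basis H u v"
    and "s\<^sub>1 < s\<^sub>2"
    and x: "\<And>s. s \<in> {s\<^sub>1<..<s\<^sub>2} \<Longrightarrow> (x has_vector_derivative x' s) (at s)"
      "\<And>s. s \<in> {s\<^sub>1<..<s\<^sub>2} \<Longrightarrow> norm (x' s) = 1" "continuous_on {s\<^sub>1<..<s\<^sub>2} x'"
    and h: "\<And>r. (h has_real_derivative h' r) (at r)" "continuous_on UNIV h'"
    and slope: "\<And>s. s \<in> {s\<^sub>1<..<s\<^sub>2} \<Longrightarrow> x' s \<bullet> hg H = h' (x s \<bullet> hf H) * (x' s \<bullet> hf H)"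
  shows "\<exists>c. given_by x s\<^sub>1 s\<^sub>2 (\<lambda>t. t *\<^sub>R u + (h t + c) *\<^sub>R v)"
proof -
  note expand = dual_basis_expansion(2)[OF indep uv]
  have d: "((\<lambda>s. x s \<bullet> w) has_real_derivative x' s \<bullet> w) (at s)" if "s \<in> {s\<^sub>1<..<s\<^sub>2}" for s w
    by (rule has_real_derivative_inner_left[OF x(1)[OF that]])
  have "((\<lambda>s. x s \<bullet> hg H - h (x s \<bullet> hf H)) has_real_derivative 0) (at s within {s\<^sub>1<..<s\<^sub>2})"
    if s: "s \<in> {s\<^sub>1<..<s\<^sub>2}" for s
    using DERIV_diff[OF d[OF s] DERIV_chain2[OF h(1) d[OF s]], of "hg H" "hf H"] slope[OF s]
    by (simp add: has_field_derivative_at_within)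
  then obtain c where c: "\<And>s. s \<in> {s\<^sub>1<..<s\<^sub>2} \<Longrightarrow> x s \<bullet> hg H - h (x s \<bullet> hf H) = c"
    using has_field_derivative_zero_constant[of "{s\<^sub>1<..<s\<^sub>2}" "\<lambda>s. x s \<bullet> hg H - h (x s \<bullet> hf H)"] by auto
  have nz: "hf H \<noteq> 0" using indep by auto
  let ?y = "\<lambda>t. t *\<^sub>R u + (h t + c) *\<^sub>R v"
  have "given_by x s\<^sub>1 s\<^sub>2 ?y"
  proof (rule given_by_of_regular[of _ _ _ "\<lambda>t. u + h' t *\<^sub>R v" "1 / norm (hf H)"
        "\<lambda>s. x s \<bullet> hf H" "\<lambda>s. x' s \<bullet> hf H" _ x'])
    fix r
    have "(?y has_vector_derivative (r *\<^sub>R 0 + 1 *\<^sub>R u) + ((h r + c) *\<^sub>R 0 + (h' r + 0) *\<^sub>R v)) (at r)"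
      by (intro has_vector_derivative_add has_vector_derivative_scaleR has_vector_derivative_const
          DERIV_ident DERIV_add DERIV_const h(1))
    then show "(?y has_vector_derivative u + h' r *\<^sub>R v) (at r)" by simp
    \<comment> \<open>Pairing the velocity with \<open>hf H\<close> gives a bound on the speed from
      below, uniform in \<open>r\<close>.\<close>
    have "1 = (u + h' r *\<^sub>R v) \<bullet> hf H" using uv by (simp add: dual_basis_def inner_add_left)
    also have "\<dots> \<le> norm (u + h' r *\<^sub>R v) * norm (hf H)" by (rule norm_cauchy_schwarz)
    finally show "1 / norm (hf H) \<le> norm (u + h' r *\<^sub>R v)" using nz by (simp add: divide_le_eq)
  next
    fix s assume s: "s \<in> {s\<^sub>1<..<s\<^sub>2}"
    \<comment> \<open>By \<open>slope\<close>, a tangent orthogonal to \<open>hf H\<close> is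
      orthogonal to \<open>hg H\<close> too, hence zero.\<close>
    show "x' s \<bullet> hf H \<noteq> 0"
    proof
      assume "x' s \<bullet> hf H = 0"
      with slope[OF s] have "x' s \<bullet> hg H = 0" by simp
      with \<open>x' s \<bullet> hf H = 0\<close> have "x' s = 0" by (rule eq_0_if_orthogonal_to_generators[OF indep])
      then show False using x(2)[OF s] by simp
    qed
    have "x s \<bullet> hg H = h (x s \<bullet> hf H) + c" using c[OF s] by simp
    from expand[of "x s", unfolded this] show "x s = ?y (x s \<bullet> hf H)" .
    show "((\<lambda>s. x s \<bullet> hf H) has_real_derivative x' s \<bullet> hf H) (at s)" by (rule d[OF s])
    show "(x has_vector_derivative x' s) (at s)" "norm (x' s) = 1" using x s by blast+
  next
    show "continuous_on UNIV (\<lambda>t. u + h' t *\<^sub>R v)" by (intro continuous_intros h(2))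
    show "continuous_on {s\<^sub>1<..<s\<^sub>2} (\<lambda>s. x' s \<bullet> hf H)" by (intro continuous_intros x(3))
  qed (use nz \<open>s\<^sub>1 < s\<^sub>2\<close> in simp_all)
  then show ?thesis by blast
qed

section \<open>The two types of elliptic interfaces\<close>

theorem theorem6p2:
  fixes A B :: helix
    and s\<^sub>1 s\<^sub>2 :: real
    and x :: "real \<Rightarrow> real^2"
    and \<kappa> :: "real \<Rightarrow> real"
    and e\<^sub>1 e\<^sub>2 e\<^sub>3 :: "real^3"
  assumes "helical_data A" and "helical_data B"
    and "helical_group A \<noteq> helical_group B"
    and "cross3 (hax B) (hax A) \<noteq> 0"
    and "e\<^sub>1 = cross3 (hax B) (hax A) /\<^sub>R norm (cross3 (hax B) (hax A))"
    and "e\<^sub>2 = (hax B - hax A) /\<^sub>R norm (hax B - hax A)"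
    and "e\<^sub>3 = cross3 e\<^sub>1 e\<^sub>2"
    and "interface A B s\<^sub>1 s\<^sub>2 x"
    and "is_curvature x s\<^sub>1 s\<^sub>2 \<kappa>"
    and "\<forall>s\<in>{s\<^sub>1<..<s\<^sub>2}. \<kappa> s \<noteq> 0"
    and "locally_compatible A B s\<^sub>1 s\<^sub>2 x"
  shows "norm e\<^sub>1 = 1 \<and> norm e\<^sub>2 = 1 \<and> norm e\<^sub>3 = 1 \<and>
         e\<^sub>1 \<bullet> e\<^sub>2 = 0 \<and> e\<^sub>1 \<bullet> e\<^sub>3 = 0 \<and> e\<^sub>2 \<bullet> e\<^sub>3 = 0 \<and>
         (\<exists>!\<xi>. tilt_angle A B e\<^sub>2 e\<^sub>3 \<xi>) \<and>
         (\<exists>!(\<rho>, \<theta>). polar_data A e\<^sub>1 \<rho> \<theta>) \<and>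
         (\<exists>!(\<rho>, \<theta>). polar_data B e\<^sub>1 \<rho> \<theta>) \<and>
         (\<exists>!(u, v). dual_basis B u v) \<and>
         (\<forall>\<xi> \<rho>\<^sub>a \<theta>\<^sub>a \<rho>\<^sub>b \<theta>\<^sub>b u v.
            tilt_angle A B e\<^sub>2 e\<^sub>3 \<xi> \<and> polar_data A e\<^sub>1 \<rho>\<^sub>a \<theta>\<^sub>a \<and> polar_data B e\<^sub>1 \<rho>\<^sub>b \<theta>\<^sub>b \<and>
            dual_basis B u v \<longrightarrow>
              (hf A = hf B \<and> hg A = - hg B \<and> \<rho>\<^sub>a = \<rho>\<^sub>b \<and> \<theta>\<^sub>a = \<theta>\<^sub>b \<and>
               (\<exists>c. given_by x s\<^sub>1 s\<^sub>2
                      (\<lambda>t. t *\<^sub>R u + (\<rho>\<^sub>a * tan \<xi> * sin (t + \<theta>\<^sub>a) + c) *\<^sub>R v)))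
            \<or> (hf A = - hf B \<and> hg A = hg B \<and> \<rho>\<^sub>a = \<rho>\<^sub>b \<and>
               (\<exists>k::int. \<theta>\<^sub>a = - \<theta>\<^sub>b + 2 * pi * of_int k) \<and>
               (\<exists>c. given_by x s\<^sub>1 s\<^sub>2
                      (\<lambda>t. t *\<^sub>R u + (\<rho>\<^sub>a * cot \<xi> * sin (- t + \<theta>\<^sub>a) + c) *\<^sub>R v))))"
proof -
  have A: "norm (hax A) = 1" "hrad A \<noteq> 0" "hrad A \<bullet> hax A = 0"
    and B: "norm (hax B) = 1" "hrad B \<noteq> 0" "hrad B \<bullet> hax B = 0"
    using assms(1,2) by (simp_all add: helical_data_def)
  note frame = tilt_frame[OF A(1) B(1) assms(4-7)]
  note on = cross3_orthonormal[OF frame(1-3), folded assms(7)]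
  note indep = generators_independent[OF assms(1)] generators_independent[OF assms(2)]
  let ?I = "{s\<^sub>1<..<s\<^sub>2}" and ?t = "tangent x"
  have I: "s\<^sub>1 < s\<^sub>2" using assms(8) by (simp add: interface_def)
  have dx: "(x has_vector_derivative ?t s) (at s)" if "s \<in> ?I" for s
    using assms(8) that unfolding interface_def C1_differentiable_on_def tangent_def
    by (metis vector_derivative_at)
  obtain D where "\<And>s. s \<in> ?I \<Longrightarrow> (?t has_vector_derivative D s) (at s)"
    using assms(8) unfolding interface_def C1_differentiable_on_def by blast
  then have dt: "(?t has_vector_derivative \<kappa> s *\<^sub>R perp (?t s)) (at s)" if "s \<in> ?I" for s
    using assms(9) that unfolding is_curvature_def normal_def by (metis vector_derivative_at)
  have ct: "continuous_on ?I ?t"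
    using dt by (meson continuous_at_imp_continuous_on has_vector_derivative_continuous)
  have unit: "norm (?t s) = 1" if "s \<in> ?I" for s
    using assms(8) that by (simp add: interface_def)
  interpret turning_tangent s\<^sub>1 s\<^sub>2 ?t \<kappa>
    using I unit dt assms(10) by unfold_locales simp_all
  have main: "(hf A = hf B \<and> hg A = - hg B \<and> \<rho>\<^sub>a = \<rho>\<^sub>b \<and> \<theta>\<^sub>a = \<theta>\<^sub>b \<and>
       (\<exists>c. given_by x s\<^sub>1 s\<^sub>2 (\<lambda>t. t *\<^sub>R u + (\<rho>\<^sub>a * tan \<xi> * sin (t + \<theta>\<^sub>a) + c) *\<^sub>R v)))
    \<or> (hf A = - hf B \<and> hg A = hg B \<and> \<rho>\<^sub>a = \<rho>\<^sub>b \<and>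
       (\<exists>k::int. \<theta>\<^sub>a = - \<theta>\<^sub>b + 2 * pi * of_int k) \<and>
       (\<exists>c. given_by x s\<^sub>1 s\<^sub>2 (\<lambda>t. t *\<^sub>R u + (\<rho>\<^sub>a * cot \<xi> * sin (- t + \<theta>\<^sub>a) + c) *\<^sub>R v)))"
    if tilt: "tilt_angle A B e\<^sub>2 e\<^sub>3 \<xi>" and polA: "polar_data A e\<^sub>1 \<rho>\<^sub>a \<theta>\<^sub>a" and polB: "polar_data B e\<^sub>1 \<rho>\<^sub>b \<theta>\<^sub>b"
      and dual: "dual_basis B u v" for \<xi> \<rho>\<^sub>a \<theta>\<^sub>a \<rho>\<^sub>b \<theta>\<^sub>b u v
  proof -
    define C S where CS_def: "C = cos \<xi>" "S = sin \<xi>"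
    have CS: "C \<noteq> 0" "S \<noteq> 0" "S\<^sup>2 + C\<^sup>2 = 1"
      using frame(7,8)[OF tilt] by (simp_all add: CS_def)
    have ax: "hax A = - S *\<^sub>R e\<^sub>2 + C *\<^sub>R e\<^sub>3" "hax B = S *\<^sub>R e\<^sub>2 + C *\<^sub>R e\<^sub>3"
      using tilt by (simp_all add: tilt_angle_def CS_def)
    have "cross3 e\<^sub>2 e\<^sub>1 = - e\<^sub>3" "cross3 e\<^sub>3 e\<^sub>1 = e\<^sub>2"
      using on(2) assms(7) by (simp_all add: cross_skew[of _ e\<^sub>1])
    then have cr: "cross3 (hax A) e\<^sub>1 = C *\<^sub>R e\<^sub>2 + S *\<^sub>R e\<^sub>3" "cross3 (hax B) e\<^sub>1 = C *\<^sub>R e\<^sub>2 - S *\<^sub>R e\<^sub>3"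
      unfolding ax by (simp_all add: cross_add_left cross_mult_left Cross3.left_diff_distrib)
    have \<rho>: "\<rho>\<^sub>a > 0" "\<rho>\<^sub>b > 0" and \<theta>: "0 \<le> \<theta>\<^sub>a" "\<theta>\<^sub>a < 2 * pi" "0 \<le> \<theta>\<^sub>b" "\<theta>\<^sub>b < 2 * pi"
      using polA polB by (simp_all add: polar_data_def)
    define \<phi>\<^sub>a \<phi>\<^sub>b where \<phi>: "\<phi>\<^sub>a s = x s \<bullet> hf A + \<theta>\<^sub>a" "\<phi>\<^sub>b s = x s \<bullet> hf B + \<theta>\<^sub>b" for s
    have d: "((\<lambda>s. x s \<bullet> w + k) has_real_derivative ?t s \<bullet> w) (at s)" if "s \<in> ?I" for s w k
      using DERIV_add[OF has_real_derivative_inner_left[OF dx[OF that]] DERIV_const] by simp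
    have d\<phi>: "(\<phi>\<^sub>a has_real_derivative ?t s \<bullet> hf A) (at s)" "(\<phi>\<^sub>b has_real_derivative ?t s \<bullet> hf B) (at s)"
      if "s \<in> ?I" for s
      unfolding \<phi>[abs_def] by (rule d[OF that])+
    \<comment> \<open>The equality of velocities is tested against \<open>e\<^sub>1\<close>,
      \<open>e\<^sub>2\<close>, \<open>e\<^sub>3\<close> in turn.\<close>
    have E: "\<rho>\<^sub>a * (?t s \<bullet> hf A) * sin (\<phi>\<^sub>a s) = \<rho>\<^sub>b * (?t s \<bullet> hf B) * sin (\<phi>\<^sub>b s)"
      "(\<rho>\<^sub>a * (?t s \<bullet> hf A) * cos (\<phi>\<^sub>a s) - \<rho>\<^sub>b * (?t s \<bullet> hf B) * cos (\<phi>\<^sub>b s)) * C = (?t s \<bullet> hg A + ?t s \<bullet> hg B) * S"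
      "(\<rho>\<^sub>a * (?t s \<bullet> hf A) * cos (\<phi>\<^sub>a s) + \<rho>\<^sub>b * (?t s \<bullet> hf B) * cos (\<phi>\<^sub>b s)) * S = (?t s \<bullet> hg B - ?t s \<bullet> hg A) * C"
      if s: "s \<in> ?I" for s
    proof -
      define P P' where P: "P = \<rho>\<^sub>a * (?t s \<bullet> hf A)" "P' = \<rho>\<^sub>b * (?t s \<bullet> hf B)"
      note vA = vector_derivative_at[OF hpos_has_vector_derivative[OF A(1) frame(1,4) polA dx[OF s]]]
      note vB = vector_derivative_at[OF hpos_has_vector_derivative[OF B(1) frame(1,5) polB dx[OF s]]]
      have "P *\<^sub>R (cos (\<phi>\<^sub>a s) *\<^sub>R cross3 (hax A) e\<^sub>1 - sin (\<phi>\<^sub>a s) *\<^sub>R e\<^sub>1) + (?t s \<bullet> hg A) *\<^sub>R hax A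
          = P' *\<^sub>R (cos (\<phi>\<^sub>b s) *\<^sub>R cross3 (hax B) e\<^sub>1 - sin (\<phi>\<^sub>b s) *\<^sub>R e\<^sub>1) + (?t s \<bullet> hg B) *\<^sub>R hax B"
        using assms(11)[unfolded locally_compatible_def, rule_format, OF s] unfolding vA vB P \<phi> .
      from this[unfolded cr, unfolded ax]
      have eq: "(P *\<^sub>R (cos (\<phi>\<^sub>a s) *\<^sub>R (C *\<^sub>R e\<^sub>2 + S *\<^sub>R e\<^sub>3) - sin (\<phi>\<^sub>a s) *\<^sub>R e\<^sub>1)
            + (?t s \<bullet> hg A) *\<^sub>R (- S *\<^sub>R e\<^sub>2 + C *\<^sub>R e\<^sub>3)) \<bullet> w
          = (P' *\<^sub>R (cos (\<phi>\<^sub>b s) *\<^sub>R (C *\<^sub>R e\<^sub>2 - S *\<^sub>R e\<^sub>3) - sin (\<phi>\<^sub>b s) *\<^sub>R e\<^sub>1)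
            + (?t s \<bullet> hg B) *\<^sub>R (S *\<^sub>R e\<^sub>2 + C *\<^sub>R e\<^sub>3)) \<bullet> w" for w
        by (rule arg_cong)
      have dots: "e\<^sub>1 \<bullet> e\<^sub>1 = 1" "e\<^sub>2 \<bullet> e\<^sub>2 = 1" "e\<^sub>3 \<bullet> e\<^sub>3 = 1" "e\<^sub>1 \<bullet> e\<^sub>2 = 0" "e\<^sub>2 \<bullet> e\<^sub>1 = 0"
        "e\<^sub>1 \<bullet> e\<^sub>3 = 0" "e\<^sub>3 \<bullet> e\<^sub>1 = 0" "e\<^sub>2 \<bullet> e\<^sub>3 = 0" "e\<^sub>3 \<bullet> e\<^sub>2 = 0"
        using frame(1-3) on(1,3,4) by (simp_all add: norm_eq_1 inner_commute)
      note lin = inner_add_left inner_diff_left inner_scaleR_left inner_minus_left dots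
      show "P * sin (\<phi>\<^sub>a s) = P' * sin (\<phi>\<^sub>b s)"
        using eq[of e\<^sub>1] by (simp add: lin)
      show "(P * cos (\<phi>\<^sub>a s) - P' * cos (\<phi>\<^sub>b s)) * C = (?t s \<bullet> hg A + ?t s \<bullet> hg B) * S"
        using eq[of e\<^sub>2] by (simp add: lin algebra_simps)
      show "(P * cos (\<phi>\<^sub>a s) + P' * cos (\<phi>\<^sub>b s)) * S = (?t s \<bullet> hg B - ?t s \<bullet> hg A) * C"
        using eq[of e\<^sub>3] by (simp add: lin algebra_simps)
    qed
    have rigid: "\<rho>\<^sub>a = \<rho>\<^sub>b \<and> (hf A = hf B \<and> hg A = - hg B \<or> hf A = - hf B \<and> hg A = hg B)"
      by (rule compatible_frames[OF indep(1) \<rho> CS d\<phi> E])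
    \<comment> \<open>One point of the curve suffices to compare the constants
      \<open>\<theta>\<^sub>a\<close> and \<open>\<theta>\<^sub>b\<close>.\<close>
    obtain s where s: "s \<in> ?I" using I dense by auto
    from rigid show ?thesis
    proof (elim conjE disjE)
      assume eq: "\<rho>\<^sub>a = \<rho>\<^sub>b" "hf A = hf B" "hg A = - hg B"
      \<comment> \<open>The axial terms cancel in \<open>E(2)\<close>, so \<open>E(1)\<close> and
        \<open>E(2)\<close> match the angles, and \<open>E(3)\<close> becomes the slope of the
        graph.\<close>
      have slope: "?t s \<bullet> hg B = \<rho>\<^sub>a * tan \<xi> * cos (x s \<bullet> hf B + \<theta>\<^sub>a) * (?t s \<bullet> hf B)"
        and same: "(?t s \<bullet> hf B) * (cos (\<phi>\<^sub>a s) - cos (\<phi>\<^sub>b s)) = 0" "(?t s \<bullet> hf B) * (sin (\<phi>\<^sub>a s) - sin (\<phi>\<^sub>b s)) = 0"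
        if "s \<in> ?I" for s
      proof -
        have "\<rho>\<^sub>a * C * ((?t s \<bullet> hf B) * (cos (\<phi>\<^sub>a s) - cos (\<phi>\<^sub>b s))) = 0"
          "\<rho>\<^sub>a * ((?t s \<bullet> hf B) * (sin (\<phi>\<^sub>a s) - sin (\<phi>\<^sub>b s))) = 0"
          using E(1,2)[OF that] unfolding eq inner_minus_right by algebra+
        then show same: "(?t s \<bullet> hf B) * (cos (\<phi>\<^sub>a s) - cos (\<phi>\<^sub>b s)) = 0"
            "(?t s \<bullet> hf B) * (sin (\<phi>\<^sub>a s) - sin (\<phi>\<^sub>b s)) = 0"
          using \<rho> CS by auto
        have "\<rho>\<^sub>a * (?t s \<bullet> hf B) * cos (\<phi>\<^sub>a s) * S = (?t s \<bullet> hg B) * C"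
          using E(3)[OF that] same(1) unfolding eq inner_minus_right by algebra
        then show "?t s \<bullet> hg B = \<rho>\<^sub>a * tan \<xi> * cos (x s \<bullet> hf B + \<theta>\<^sub>a) * (?t s \<bullet> hf B)"
          using CS(1) unfolding \<phi> eq tan_def by (simp add: CS_def field_simps)
      qed
      have "?t s \<bullet> hf B \<noteq> 0"
      proof
        assume "?t s \<bullet> hf B = 0"
        with slope[OF s] have "?t s \<bullet> hg B = 0" by simp
        with \<open>?t s \<bullet> hf B = 0\<close> have "?t s = 0"
          by (rule eq_0_if_orthogonal_to_generators[OF indep(2)])
        then show False using unit[OF s] by simp
      qed
      then have "sin (\<phi>\<^sub>a s) = sin (\<phi>\<^sub>b s) \<and> cos (\<phi>\<^sub>a s) = cos (\<phi>\<^sub>b s)" using same[OF s] by simp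
      then obtain n :: int where n: "\<phi>\<^sub>a s = \<phi>\<^sub>b s + 2 * pi * n" using sin_cos_eq_iff by blast
      \<comment> \<open>The terms in \<open>x s\<close> cancel, leaving two angles in
        \<open>[0, 2 * pi)\<close> that differ by less than a full turn.\<close>
      then have "\<bar>2 * pi * n\<bar> < 2 * pi * 1" using \<theta> unfolding \<phi> eq by linarith
      then have "\<bar>real_of_int n\<bar> < 1" by (simp add: abs_mult)
      then have "n = 0" by linarith
      then have "\<theta>\<^sub>a = \<theta>\<^sub>b" using n by (simp add: \<phi> eq)
      moreover have "\<exists>c. given_by x s\<^sub>1 s\<^sub>2 (\<lambda>t. t *\<^sub>R u + (\<rho>\<^sub>a * tan \<xi> * sin (t + \<theta>\<^sub>a) + c) *\<^sub>R v)"
      proof (rule graph_given_by[OF indep(2) dual I dx unit ct])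
        show "((\<lambda>r. \<rho>\<^sub>a * tan \<xi> * sin (r + \<theta>\<^sub>a)) has_real_derivative \<rho>\<^sub>a * tan \<xi> * cos (r + \<theta>\<^sub>a)) (at r)" for r
          by (rule derivative_eq_intros refl)+ simp
        show "continuous_on UNIV (\<lambda>r. \<rho>\<^sub>a * tan \<xi> * cos (r + \<theta>\<^sub>a))" by (intro continuous_intros)
      qed (use slope in auto)
      ultimately show ?thesis using eq by simp
    next
      assume eq: "\<rho>\<^sub>a = \<rho>\<^sub>b" "hf A = - hf B" "hg A = hg B"
      \<comment> \<open>Now the axial terms cancel in \<open>E(3)\<close>: \<open>E(1)\<close> and
        \<open>E(3)\<close> match the angles up to reflection, and \<open>E(2)\<close> becomes the
        slope.\<close>
      have slope: "?t s \<bullet> hg B = - \<rho>\<^sub>a * cot \<xi> * cos (- (x s \<bullet> hf B) + \<theta>\<^sub>a) * (?t s \<bullet> hf B)"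
        and same: "(?t s \<bullet> hf B) * (cos (\<phi>\<^sub>a s) - cos (\<phi>\<^sub>b s)) = 0" "(?t s \<bullet> hf B) * (sin (\<phi>\<^sub>a s) + sin (\<phi>\<^sub>b s)) = 0"
        if "s \<in> ?I" for s
      proof -
        have "\<rho>\<^sub>a * S * ((?t s \<bullet> hf B) * (cos (\<phi>\<^sub>a s) - cos (\<phi>\<^sub>b s))) = 0"
          "\<rho>\<^sub>a * ((?t s \<bullet> hf B) * (sin (\<phi>\<^sub>a s) + sin (\<phi>\<^sub>b s))) = 0"
          using E(1,3)[OF that] unfolding eq inner_minus_right by algebra+
        then show same: "(?t s \<bullet> hf B) * (cos (\<phi>\<^sub>a s) - cos (\<phi>\<^sub>b s)) = 0"
            "(?t s \<bullet> hf B) * (sin (\<phi>\<^sub>a s) + sin (\<phi>\<^sub>b s)) = 0"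
          using \<rho> CS by auto
        have "- \<rho>\<^sub>a * (?t s \<bullet> hf B) * cos (\<phi>\<^sub>a s) * C = (?t s \<bullet> hg B) * S"
          using E(2)[OF that] same(1) unfolding eq inner_minus_right by algebra
        then show "?t s \<bullet> hg B = - \<rho>\<^sub>a * cot \<xi> * cos (- (x s \<bullet> hf B) + \<theta>\<^sub>a) * (?t s \<bullet> hf B)"
          using CS(2) unfolding \<phi> eq cot_def inner_minus_right by (simp add: CS_def field_simps)
      qed
      have "?t s \<bullet> hf B \<noteq> 0"
      proof
        assume "?t s \<bullet> hf B = 0"
        with slope[OF s] have "?t s \<bullet> hg B = 0" by simp
        with \<open>?t s \<bullet> hf B = 0\<close> have "?t s = 0"
          by (rule eq_0_if_orthogonal_to_generators[OF indep(2)])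
        then show False using unit[OF s] by simp
      qed
      then have "sin (- \<phi>\<^sub>a s) = sin (\<phi>\<^sub>b s) \<and> cos (- \<phi>\<^sub>a s) = cos (\<phi>\<^sub>b s)" using same[OF s] by simp
      then obtain n :: int where n: "- \<phi>\<^sub>a s = \<phi>\<^sub>b s + 2 * pi * n" using sin_cos_eq_iff by blast
      \<comment> \<open>The sum of two angles in \<open>[0, 2 * pi)\<close> may be 0 or a full turn,
        so the relation holds only modulo \<open>2 * pi\<close>.\<close>
      then have "\<theta>\<^sub>a = - \<theta>\<^sub>b + 2 * pi * of_int (- n)" by (simp add: \<phi> eq)
      then have "\<exists>k::int. \<theta>\<^sub>a = - \<theta>\<^sub>b + 2 * pi * of_int k" by blast
      moreover have "\<exists>c. given_by x s\<^sub>1 s\<^sub>2 (\<lambda>t. t *\<^sub>R u + (\<rho>\<^sub>a * cot \<xi> * sin (- t + \<theta>\<^sub>a) + c) *\<^sub>R v)"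
      proof (rule graph_given_by[OF indep(2) dual I dx unit ct])
        show "((\<lambda>r. \<rho>\<^sub>a * cot \<xi> * sin (- r + \<theta>\<^sub>a)) has_real_derivative - \<rho>\<^sub>a * cot \<xi> * cos (- r + \<theta>\<^sub>a)) (at r)" for r
          by (rule derivative_eq_intros refl)+ simp
        show "continuous_on UNIV (\<lambda>r. - \<rho>\<^sub>a * cot \<xi> * cos (- r + \<theta>\<^sub>a))" by (intro continuous_intros)
      qed (use slope in auto)
      ultimately show ?thesis using eq by simp
    qed
  qed
  have "\<exists>!(\<rho>, \<theta>). polar_data A e\<^sub>1 \<rho> \<theta>" "\<exists>!(\<rho>, \<theta>). polar_data B e\<^sub>1 \<rho> \<theta>"
    by (rule ex1_polar_data[OF A(1) frame(1,4) A(2,3)], rule ex1_polar_data[OF B(1) frame(1,5) B(2,3)])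
  then show ?thesis
    using frame(1-3,6) on(1,3,4) dual_basis_expansion(1)[OF indep(2)] main
    by (intro conjI allI impI) (assumption | elim conjE)+
qed

end
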